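(* Let $\pi^*=(\pi^*_T)_{T\in\mathcal T}$ be a solution (minimizer) of the optimization problem $$\text{minimize}_{\pi}\ \operatorname{trace}(\mathbf g_\pi^\infty(\Sigma))\quad\text{subject to}\quad \sum_{T\in\mathcal T}\pi_T\,\mathcal E(T)\le \mathcal E_d,\ \ \pi_T\ge 0,\ \ \sum_{T\in\mathcal T}\pi_T=1 .$$ Assume that 1. $A$ is invertible and $(A,Q^{1/2})$ is controllable; 2. there exists $T\in\mathcal T$ with $\pi^*_T>0$ such that $(C_T,A)$ is observable. Let the stochastic process $\{P_k\}$ be defined by $P_0=\Sigma$ and $P_k=\mathbf g_{\pi^*,k}(P_{k-1})$ for $k\ge 1$. Then, almost surely, $$\lim_{N\to\infty}\frac1N\sum_{k=1}^N \operatorname{trace}(P_k)\ \le\ \operatorname{trace}(\mathbf g_{\pi^*}^\infty(\Sigma)),$$ where the limit is understood to exist in $[0,+\infty]$.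
   Context: Data: $A\in\mathbb R^{n\times n}$; $Q,\Sigma\in\mathbb R^{n\times n}$ symmetric positive definite; row vectors $C_1,\dots,C_m\in\mathbb R^{1\times n}$ stacked as $C=[C_1',\dots,C_m']'\in\mathbb R^{m\times n}$ (prime denotes transpose), with $(C,A)$ observable; noise variances $r_1,\dots,r_m>0$; an energy threshold $\mathcal E_d\in\mathbb R$. Network: a directed tree $G$ with vertex set $V=\{s_0,s_1,\dots,s_m\}$ (fusion center $s_0$, sensors $s_1,\dots,s_m$), in which each sensor $s_i$, $i\ge1$, has exactly one outgoing edge (to its parent), and every sensor has a unique directed path to $s_0$. The outgoing edge of $s_i$ has a real weight $c_i$ (energy consumption). $\mathcal T$ is the finite set of all subtrees $T=(V_T,E_T)$ of $G$ containing $s_0$ (so each node of $T$ is joined to $s_0$ by a path in $T$). The cost $\mathcal E(T)$ is the sum of the weights of the edges in $E_T$. For $T\in\mathcal T$ with $V_T=\{s_0,s_{i_1},\dots,s_{i_j}\}$, put $C_T=[C_{i_1}',\dots,C_{i_j}']'$. For $T\in\mathcal T$ and $X\in\mathbb R^{n\times n}$ symmetric positive semidefinite define $$g_T(X)=\Big[(AXA'+Q)^{-1}+\sum_{s_i\in V_T,\ s_i\ne s_0}\frac{C_i'C_i}{r_i}\Big]^{-1}.$$ Given a probability vector $\pi=(\pi_T)_{T\in\mathcal T}$, at each time $k\ge1$ exactly one tree is selected at random, independently over time, tree $T$ being selected with probability $\pi_T$; let $\delta_{k,T}=1$ if $T$ is selected at time $k$ and $0$ otherwise. Define the random operator $\mathbf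 g_{\pi,k}(X)=\sum_{T\in\mathcal T}\delta_{k,T}\,g_T(X)$. Define $$\mathbf g_\pi^\infty(X)=\lim_{k\to\infty}\mathbb E\big[(\mathbf g_{\pi,k}\circ\mathbf g_{\pi,k-1}\circ\cdots\circ\mathbf g_{\pi,1})(X)\big]$$ when this (finite) limit exists; otherwise $\mathbf g^\infty_\pi(X)$ is infinity, and its trace is $+\infty$. *)

theory Defs
  imports "HOL-Probability.Probability" "Graph_Theory.Pair_Digraph" "Graph_Theory.Digraph_Component"
begin

definition psd_matrix :: "real^'n^'n \<Rightarrow> bool" where
  "psd_matrix M \<longleftrightarrow> transpose M = M \<and> (\<forall>x. 0 \<le> x \<bullet> (M *v x))"

definition pd_matrix :: "real^'n^'n \<Rightarrow> bool" where
  "pd_matrix M \<longleftrightarrow> transpose M = M \<and> (\<forall>x. x \<noteq> 0 \<longrightarrow> 0 < x \<bullet> (M *v x))"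

definition psd_sqrt :: "real^'n^'n \<Rightarrow> real^'n^'n" where
  "psd_sqrt M = (THE R. psd_matrix R \<and> R ** R = M)"

definition mat_pow :: "real^'n^'n \<Rightarrow> nat \<Rightarrow> real^'n^'n" where
  "mat_pow A k = (((**) A) ^^ k) (mat 1)"

text \<open>
  The number of rows of a stacked matrix depends on the selected sensors, so such a matrix is
  represented by the set of indices of the rows of \<open>C\<close> that it consists of.  The set below
  consists of the rows of the observability matrix of that submatrix and \<open>A\<close>; its
  dimension is the rank of the observability matrix (cf. \<open>row_rank_def\<close>).
\<close>
definition observable :: "'m set \<Rightarrow> real^'n^'m \<Rightarrow> real^'n^'n \<Rightarrow> bool" where
  "observable I C A \<longleftrightarrow>
     dim {row i (C ** mat_pow A k) | i k. i \<in> I \<and> k < CARD('n)} = CARD('n)"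

text \<open>The columns of the controllability matrix \<open>[B, A B, \<dots>]\<close> (cf. \<open>column_rank_def\<close>).\<close>
definition controllable :: "real^'n^'n \<Rightarrow> real^'p^'n \<Rightarrow> bool" where
  "controllable A B \<longleftrightarrow>
     dim {column j (mat_pow A k ** B) | j k. k < CARD('n)} = CARD('n)"

text \<open>
  Vertices have type \<open>'m option\<close>: \<open>None\<close> is the fusion center \<open>s\<^sub>0\<close> and \<open>Some i\<close> is the
  sensor \<open>s\<^sub>i\<close>.  Edges point towards the fusion center.  The predicate \<open>tree\<close> of the graph
  library excludes directed cycles only; here every vertex has a unique walk to the root.
  Uniqueness of the empty walk at the root itself entails that the root has no outgoing edge.
\<close>
definition in_tree :: "'v pair_pre_digraph \<Rightarrow> 'v \<Rightarrow> bool" where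
  "in_tree G s \<longleftrightarrow> pair_fin_digraph G \<and> s \<in> pverts G \<and>
     (\<forall>v \<in> pverts G. \<exists>!p. pre_digraph.awalk (with_proj G) v p s)"

definition sensor_network :: "('m::finite) option pair_pre_digraph \<Rightarrow> bool" where
  "sensor_network G \<longleftrightarrow> pverts G = UNIV \<and> in_tree G None \<and>
     (\<forall>i. \<exists>!e. e \<in> parcs G \<and> fst e = Some i)"

definition rooted_subtrees :: "'m option pair_pre_digraph \<Rightarrow> 'm option pair_pre_digraph set" where
  "rooted_subtrees G = {T. subgraph (with_proj T) (with_proj G) \<and> in_tree T None}"

definition sensors :: "'m option pair_pre_digraph \<Rightarrow> 'm set" where
  "sensors T = {i. Some i \<in> pverts T}"

text \<open>
  The weight of an edge is attached to the sensor at its tail; the fusion center has no outgoing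
  edge, so the value in the case \<open>None\<close> is irrelevant.
\<close>
definition tree_cost :: "('m \<Rightarrow> real) \<Rightarrow> 'm option pair_pre_digraph \<Rightarrow> real" where
  "tree_cost c T = (\<Sum>e \<in> parcs T. case fst e of None \<Rightarrow> 0 | Some i \<Rightarrow> c i)"

definition g_tree ::
  "real^'n^'n \<Rightarrow> real^'n^'n \<Rightarrow> real^'n^'m \<Rightarrow> ('m \<Rightarrow> real) \<Rightarrow>
   'm option pair_pre_digraph \<Rightarrow> real^'n^'n \<Rightarrow> real^'n^'n" where
  "g_tree A Q C r T X =
     matrix_inv (matrix_inv (A ** X ** transpose A + Q) +
       (\<Sum>i \<in> sensors T.
          (1 / r i) *\<^sub>R (transpose (rowvector (row i C) :: real^'n^1) ** rowvector (row i C))))"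

text \<open>
  The random operator at time \<open>k\<close> when \<open>\<sigma> k\<close> is the tree selected at time \<open>k\<close>.
\<close>
definition g_random ::
  "real^'n^'n \<Rightarrow> real^'n^'n \<Rightarrow> real^'n^'m \<Rightarrow> ('m \<Rightarrow> real) \<Rightarrow> 'm option pair_pre_digraph \<Rightarrow>
   (nat \<Rightarrow> 'm option pair_pre_digraph) \<Rightarrow> nat \<Rightarrow> real^'n^'n \<Rightarrow> real^'n^'n" where
  "g_random A Q C r G \<sigma> k X =
     (\<Sum>T \<in> rooted_subtrees G. of_bool (\<sigma> k = T) *\<^sub>R g_tree A Q C r T X)"

primrec g_iter ::
  "real^'n^'n \<Rightarrow> real^'n^'n \<Rightarrow> real^'n^'m \<Rightarrow> ('m \<Rightarrow> real) \<Rightarrow> 'm option pair_pre_digraph \<Rightarrow>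
   (nat \<Rightarrow> 'm option pair_pre_digraph) \<Rightarrow> nat \<Rightarrow> real^'n^'n \<Rightarrow> real^'n^'n" where
  "g_iter A Q C r G \<sigma> 0 X = X"
| "g_iter A Q C r G \<sigma> (Suc k) X = g_random A Q C r G \<sigma> (Suc k) (g_iter A Q C r G \<sigma> k X)"

text \<open>The joint law of independent selections at the times \<open>k \<ge> 1\<close>.\<close>
definition selection_measure ::
  "'m option pair_pre_digraph \<Rightarrow> ('m option pair_pre_digraph \<Rightarrow> real) \<Rightarrow>
   (nat \<Rightarrow> 'm option pair_pre_digraph) measure" where
  "selection_measure G \<pi> =
     (\<Pi>\<^sub>M k \<in> {1..}. point_measure (rooted_subtrees G) (\<lambda>T. ennreal (\<pi> T)))"

definition g_mean ::
  "real^'n^'n \<Rightarrow> real^'n^'n \<Rightarrow> real^'n^'m \<Rightarrow> ('m \<Rightarrow> real) \<Rightarrow> 'm option pair_pre_digraph \<Rightarrow>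
   ('m option pair_pre_digraph \<Rightarrow> real) \<Rightarrow> nat \<Rightarrow> real^'n^'n \<Rightarrow> real^'n^'n" where
  "g_mean A Q C r G \<pi> k X = (\<integral>\<sigma>. g_iter A Q C r G \<sigma> k X \<partial>selection_measure G \<pi>)"

text \<open>\<open>None\<close> stands for the value infinity, taken when there is no finite limit.\<close>
definition g_limit ::
  "real^'n^'n \<Rightarrow> real^'n^'n \<Rightarrow> real^'n^'m \<Rightarrow> ('m \<Rightarrow> real) \<Rightarrow> 'm option pair_pre_digraph \<Rightarrow>
   ('m option pair_pre_digraph \<Rightarrow> real) \<Rightarrow> real^'n^'n \<Rightarrow> (real^'n^'n) option" where
  "g_limit A Q C r G \<pi> X =
     (if convergent (\<lambda>k. g_mean A Q C r G \<pi> k X)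
      then Some (lim (\<lambda>k. g_mean A Q C r G \<pi> k X)) else None)"

definition ext_trace :: "(real^'n^'n) option \<Rightarrow> ereal" where
  "ext_trace Y = (case Y of None \<Rightarrow> \<infinity> | Some M \<Rightarrow> ereal (trace M))"

definition feasible ::
  "'m option pair_pre_digraph \<Rightarrow> ('m \<Rightarrow> real) \<Rightarrow> real \<Rightarrow>
   ('m option pair_pre_digraph \<Rightarrow> real) \<Rightarrow> bool" where
  "feasible G c Ed \<pi> \<longleftrightarrow>
     (\<Sum>T \<in> rooted_subtrees G. \<pi> T * tree_cost c T) \<le> Ed \<and>
     (\<forall>T \<in> rooted_subtrees G. 0 \<le> \<pi> T) \<and> (\<Sum>T \<in> rooted_subtrees G. \<pi> T) = 1"

end

theory Submission
  imports Defs
begin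

text \<open>
  The covariance \<open>P\<^sub>k\<close> is obtained by applying independent, identically distributed random maps
  \<open>g\<^sub>T\<close> one after the other.  Each map is monotone for the Loewner order, and this makes the
  time averages converge when the process is started from \<open>0\<close>.  Restarting the process from
  \<open>0\<close> at a time \<open>m\<close> replaces the current covariance by a smaller one, so the sums
  \<open>f n\<close> of the first \<open>n\<close> traces satisfy \<open>f m + f n \<circ> \<theta>\<^sup>m \<le> f (m + n)\<close>, where \<open>\<theta>\<close>
  is the shift of the selection sequence: they are superadditive over an ergodic shift.  As in
  Kingman's theorem, \<open>f n / n\<close> converges almost surely to \<open>L = sup\<^sub>k e\<^sub>k\<close>, where \<open>e\<^sub>k\<close> is the expected
  trace after \<open>k\<close> steps from \<open>0\<close> and \<open>L = \<infinity>\<close> is possible.  The upper bound is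
  \<open>superadditive_upper\<close>, a covering argument combined with ergodicity (\<open>ergodic_shift\<close>); the
  lower bound applies the same theorem to the complementary sums of a bounded function
  (\<open>birkhoff_lower\<close>), because the trace at time \<open>j + k\<close> is at least the trace obtained from \<open>0\<close>
  by the last \<open>k\<close> selections alone.

  The limit is the same for every starting value.  For \<open>L = \<infinity>\<close> the lower bound is enough.  If
  \<open>L\<close> is finite, then \<open>g\<^sub>T\<close> does not increase the least factor \<open>a \<ge> 1\<close> with \<open>Y \<le> a X\<close>, and since
  \<open>Q\<close> is positive definite, it contracts \<open>a - 1\<close> by a fixed ratio whenever the trace of \<open>X\<close> is
  below a given bound (\<open>riccati_contract\<close>).  Along the process started from \<open>0\<close> this happens infinitely
  often, because its averages stay bounded.  Hence the process started from \<open>\<Sigma>\<close> is eventually at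
  most \<open>1 + \<epsilon>\<close> times the one started from \<open>0\<close> (\<open>cocycle_forgets_start\<close>), and it has the same
  averages (\<open>average_trace_tendsto\<close>).

  Finally, \<open>e\<^sub>k\<close> is at most the trace of the mean covariance after \<open>k\<close> steps from \<open>\<Sigma>\<close>.  As
  \<open>e\<^sub>k\<close> increases to \<open>L\<close>, the trace of the limit of these means, if it exists, is at least \<open>L\<close>.
\<close>

section \<open>Superadditive processes over an ergodic transformation\<close>

text \<open>
  Call \<open>k\<close> bad if no block of length at most \<open>m\<close> starting at \<open>k\<close> has growth rate at least \<open>a\<close>.
  Cutting the orbit greedily into single bad points and blocks of rate at least \<open>a\<close> covers all but
  the last \<open>m\<close> times, and by superadditivity only the bad points and this remainder are lost.
\<close>
lemma superadditive_covering:
  fixes f :: "nat \<Rightarrow> 'a \<Rightarrow> real" and th :: "'a \<Rightarrow> 'a"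
  assumes th: "\<And>x. x \<in> X \<Longrightarrow> th x \<in> X"
    and nonneg: "\<And>n x. x \<in> X \<Longrightarrow> 0 \<le> f n x"
    and superadd: "\<And>s t x. x \<in> X \<Longrightarrow> f s x + f t ((th ^^ s) x) \<le> f (s + t) x"
    and a: "0 \<le> a" and x: "x \<in> X"
  shows "a * (real N - real m - real (card {k. k < N \<and> (\<forall>n\<in>{1..m}. f n ((th ^^ k) x) < a * real n)}))
    \<le> f N x"
  using x
proof (induction N arbitrary: x rule: less_induct)
  case (less N)
  let ?B = "\<lambda>N x. {k. k < N \<and> (\<forall>n\<in>{1..m}. f n ((th ^^ k) x) < a * real n)}"
  have pow: "(th ^^ k) x \<in> X" for k
    by (induction k) (auto simp: th less.prems)
  have shift: "card (?B (N - s) ((th ^^ s) x)) + (if s = 1 \<and> 0 \<in> ?B N x then 1 else 0) \<le> card (?B N x)"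
    if "s \<le> N" "1 \<le> s" for s
  proof -
    have sub: "(\<lambda>k. k + s) ` ?B (N - s) ((th ^^ s) x) \<subseteq> ?B N x - {0}"
      using that by (auto simp: funpow_add)
    have "card (?B (N - s) ((th ^^ s) x)) = card ((\<lambda>k. k + s) ` ?B (N - s) ((th ^^ s) x))"
      by (rule card_image[symmetric]) auto
    also have "\<dots> \<le> card (?B N x - {0})"
      using sub by (rule card_mono[rotated]) simp
    also have "\<dots> + (if s = 1 \<and> 0 \<in> ?B N x then 1 else 0) \<le> card (?B N x)"
    proof (cases "s = 1 \<and> 0 \<in> ?B N x")
      case True
      then have "card (?B N x) = Suc (card (?B N x - {0}))"
        by (intro card.remove) auto
      then show ?thesis using True by simp
    next
      case False
      then show ?thesis by (auto intro!: card_mono)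
    qed
    finally show ?thesis by linarith
  qed
  show ?case
  proof (cases "N \<le> m")
    case True
    then have "a * (real N - real m - real (card (?B N x))) \<le> 0"
      using a by (intro mult_nonneg_nonpos) auto
    then show ?thesis using nonneg[OF less.prems, of N] by linarith
  next
    case False
    \<comment> \<open>Advance by one step from a bad point, and by the length of a good block from a good one.\<close>
    obtain s where s: "1 \<le> s" "s \<le> N"
      and gain: "a * (real s - (if s = 1 \<and> 0 \<in> ?B N x then 1 else 0)) \<le> f s x"
    proof (cases "0 \<in> ?B N x")
      case True
      then show ?thesis using that[of 1] False nonneg[OF less.prems, of 1] by auto
    next
      case nb: False
      then obtain n where "n \<in> {1..m}" "a * real n \<le> f n x"
        using False by (auto simp: not_less)
      moreover from this False have "1 \<le> n" "n \<le> N" by auto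
      moreover have "\<not> (n = 1 \<and> 0 \<in> ?B N x)" using nb by blast
      ultimately show ?thesis by (intro that[of n]) auto
    qed
    let ?i = "if s = 1 \<and> 0 \<in> ?B N x then 1 else 0 :: real"
    have IH: "a * (real (N - s) - real m - real (card (?B (N - s) ((th ^^ s) x)))) \<le> f (N - s) ((th ^^ s) x)"
      using s by (intro less.IH pow) auto
    have "real (card (?B (N - s) ((th ^^ s) x))) + ?i \<le> real (card (?B N x))"
      using shift[OF s(2,1)] by (auto simp flip: of_nat_Suc split: if_splits)
    then have "a * (real N - real m - real (card (?B N x)))
      \<le> a * (real N - real m - (real (card (?B (N - s) ((th ^^ s) x))) + ?i))"
      using a by (intro mult_left_mono) auto
    also have "\<dots> = a * (real s - ?i) + a * (real (N - s) - real m - real (card (?B (N - s) ((th ^^ s) x))))"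
      using s by (simp add: of_nat_diff algebra_simps)
    also have "\<dots> \<le> f s x + f (N - s) ((th ^^ s) x)"
      using gain IH by (rule add_mono)
    also have "\<dots> \<le> f N x"
      using superadd[OF less.prems, of s "N - s"] s by simp
    finally show ?thesis .
  qed
qed

locale ergodic_system = prob_space M for M :: "'a measure" +
  fixes th :: "'a \<Rightarrow> 'a"
  assumes th_measurable [measurable]: "th \<in> measurable M M"
    and th_preserves: "distr M M th = M"
    and ergodic: "\<And>A. A \<in> sets M \<Longrightarrow> th -` A \<inter> space M = A \<Longrightarrow> prob A = 0 \<or> prob A = 1"
begin

lemma th_pow_measurable [measurable]: "(th ^^ k) \<in> measurable M M"
  by (induction k) (auto simp: measurable_comp)

lemma th_pow_space: "x \<in> space M \<Longrightarrow> (th ^^ k) x \<in> space M"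
  using th_pow_measurable by (rule measurable_space)

lemma th_pow_preserves: "distr M M (th ^^ k) = M"
proof (induction k)
  case 0
  then show ?case by (simp add: id_def distr_id)
next
  case (Suc k)
  have "distr M M (th ^^ Suc k) = distr (distr M M (th ^^ k)) M th"
    unfolding funpow.simps by (rule distr_distr[OF th_measurable th_pow_measurable, symmetric])
  then show ?case by (simp only: Suc th_preserves)
qed

lemma prob_th_pow:
  assumes "A \<in> sets M"
  shows "prob ((th ^^ k) -` A \<inter> space M) = prob A"
  using measure_distr[OF th_pow_measurable assms, of k] by (simp add: th_pow_preserves)

lemma expectation_th_pow:
  fixes \<phi> :: "'a \<Rightarrow> real"
  assumes "\<phi> \<in> borel_measurable M"
  shows "(\<integral>x. \<phi> ((th ^^ k) x) \<partial>M) = (\<integral>x. \<phi> x \<partial>M)"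
  using integral_distr[OF th_pow_measurable assms, of k] by (simp add: th_pow_preserves)

text \<open>
  Integrating the covering inequality bounds the mean growth from below by \<open>a\<close> times the
  probability that a point is not bad; by the last assumption, this probability tends to \<open>1\<close> as
  longer blocks are allowed.
\<close>
lemma superadditive_growth_le:
  fixes f :: "nat \<Rightarrow> 'a \<Rightarrow> real"
  assumes int: "\<And>n. integrable M (f n)"
    and nonneg: "\<And>n x. x \<in> space M \<Longrightarrow> 0 \<le> f n x"
    and superadd: "\<And>s t x. x \<in> space M \<Longrightarrow> f s x + f t ((th ^^ s) x) \<le> f (s + t) x"
    and mean: "\<And>n. expectation (f n) \<le> real n * l"
    and a: "0 \<le> a"
    and reach: "AE x in M. \<exists>n\<ge>1. a * real n \<le> f n x"
  shows "a \<le> l"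
proof -
  have [measurable]: "f n \<in> borel_measurable M" for n using int by simp
  define B where "B m = {x \<in> space M. \<forall>n\<in>{1..m}. f n x < a * real n}" for m
  have B [measurable]: "B m \<in> sets M" for m unfolding B_def by measurable
  have bound: "a * (1 - prob (B m)) \<le> l" for m
  proof (rule ccontr)
    assume "\<not> ?thesis"
    then have pos: "0 < a * (1 - prob (B m)) - l" by simp
    \<comment> \<open>The loss of \<open>m\<close> times at the end is negligible for large \<open>N\<close>.\<close>
    obtain N :: nat where N: "a * real m / (a * (1 - prob (B m)) - l) < real N"
      using reals_Archimedean2 by blast
    let ?Y = "\<lambda>x. \<Sum>k<N. indicator (B m) ((th ^^ k) x) :: real"
    have card: "real (card {k. k < N \<and> (\<forall>n\<in>{1..m}. f n ((th ^^ k) x) < a * real n)}) = ?Y x"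
      if "x \<in> space M" for x
    proof -
      have "?Y x = (\<Sum>k<N. if k \<in> {k. \<forall>n\<in>{1..m}. f n ((th ^^ k) x) < a * real n} then 1 else 0)"
        by (intro sum.cong) (auto simp: indicator_def B_def th_pow_space[OF that])
      also have "\<dots> = real (card ({..<N} \<inter> {k. \<forall>n\<in>{1..m}. f n ((th ^^ k) x) < a * real n}))"
        by (subst sum.inter_restrict[symmetric]) auto
      finally show ?thesis by (simp add: Int_def lessThan_def)
    qed
    have int_ind: "integrable M (\<lambda>x. indicator (B m) ((th ^^ k) x) :: real)" for k
      by (intro integrable_const_bound[of _ 1] AE_I2) auto
    have "expectation (\<lambda>x. indicator (B m) ((th ^^ k) x) :: real) = prob (B m)" for k
      by (subst expectation_th_pow) auto
    then have EY: "expectation ?Y = real N * prob (B m)"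
      by (subst Bochner_Integration.integral_sum) (auto intro: int_ind)
    have intY: "integrable M ?Y" by (intro Bochner_Integration.integrable_sum int_ind)
    have "a * (real N - real m - real N * prob (B m)) = expectation (\<lambda>x. a * (real N - real m - ?Y x))"
      by (subst integral_mult_right_zero, subst Bochner_Integration.integral_diff)
         (auto intro: intY simp: EY prob_space)
    also have "\<dots> \<le> expectation (f N)"
    proof (rule integral_mono)
      show "integrable M (\<lambda>x. a * (real N - real m - ?Y x))"
        by (intro integrable_mult_right Bochner_Integration.integrable_diff intY) auto
      fix x assume x: "x \<in> space M"
      have "a * (real N - real m
          - real (card {k. k < N \<and> (\<forall>n\<in>{1..m}. f n ((th ^^ k) x) < a * real n)})) \<le> f N x"
        by (rule superadditive_covering[OF measurable_space[OF th_measurable] nonneg superadd a x])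
      then show "a * (real N - real m - ?Y x) \<le> f N x"
        by (simp only: card[OF x])
    qed (rule int)
    also have "\<dots> \<le> real N * l" by (rule mean)
    finally have "real N * (a * (1 - prob (B m)) - l) \<le> a * real m" by (simp add: algebra_simps)
    with N pos show False by (simp add: field_simps)
  qed
  have "(\<lambda>m. prob (B m)) \<longlonglongrightarrow> prob (\<Inter>m. B m)"
    by (rule finite_Lim_measure_decseq) (auto simp: decseq_def B_def)
  moreover have "prob (\<Inter>m. B m) = 0"
  proof (rule prob_eq_0[THEN iffD2])
    show "AE x in M. x \<notin> (\<Inter>m. B m)"
      using reach
    proof eventually_elim
      case (elim x)
      then obtain n where "1 \<le> n" "a * real n \<le> f n x" by blast
      then have "x \<notin> B n" by (auto simp: B_def not_less intro!: bexI[of _ n])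
      then show ?case by blast
    qed
  qed measurable
  ultimately have "(\<lambda>m. a * (1 - prob (B m))) \<longlonglongrightarrow> a * (1 - 0)"
    by (intro tendsto_intros) simp
  then show ?thesis
    using bound by (intro LIMSEQ_le_const2) auto
qed

text \<open>
  The upper half of the superadditive ergodic theorem.  The event that \<open>f n x - a n\<close> is unbounded
  above contains its own preimage under \<open>th\<close>, because \<open>f n (th x) \<le> f (n + 1) x\<close>.  Its preimages
  under the powers of \<open>th\<close> therefore decrease to an invariant event of the same probability.
  Ergodicity leaves the probabilities \<open>0\<close> and \<open>1\<close>, and \<open>1\<close> contradicts the mean growth rate.
\<close>
theorem superadditive_upper:
  fixes f :: "nat \<Rightarrow> 'a \<Rightarrow> real"
  assumes int: "\<And>n. integrable M (f n)"
    and nonneg: "\<And>n x. x \<in> space M \<Longrightarrow> 0 \<le> f n x"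
    and superadd: "\<And>s t x. x \<in> space M \<Longrightarrow> f s x + f t ((th ^^ s) x) \<le> f (s + t) x"
    and mean: "\<And>n. expectation (f n) \<le> real n * l"
    and a: "l < a"
  shows "AE x in M. \<exists>c. \<forall>n. f n x \<le> a * real n + c"
proof -
  have [measurable]: "f n \<in> borel_measurable M" for n using int by simp
  have "0 \<le> expectation (f 1)" using nonneg by (simp add: integral_nonneg_AE)
  then have a0: "0 \<le> a" using mean[of 1] a by simp
  define E where "E = {x \<in> space M. \<forall>c::nat. \<exists>n. f n x > a * real n + real c}"
  have E [measurable]: "E \<in> sets M" unfolding E_def by measurable
  have step: "x \<in> E" if "th x \<in> E" "x \<in> space M" for x
    unfolding E_def
  proof (intro CollectI conjI allI that(2))
    fix c :: nat
    obtain d :: nat where d: "real c + a \<le> real d" using real_arch_simple by blast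
    have "\<forall>c::nat. \<exists>n. f n (th x) > a * real n + real c"
      using that(1) by (simp add: E_def)
    then obtain n where "f n (th x) > a * real n + real d" by blast
    moreover have "f n (th x) \<le> f (Suc n) x"
      using superadd[OF that(2), of 1 n] nonneg[OF that(2), of 1] by simp
    ultimately have "f (Suc n) x > a * real (Suc n) + real c"
      using d by (simp add: algebra_simps)
    then show "\<exists>n. f n x > a * real n + real c" by blast
  qed
  define F where "F k = (th ^^ k) -` E \<inter> space M" for k
  have F [measurable]: "F k \<in> sets M" for k unfolding F_def by measurable
  have dec: "F (Suc k) \<subseteq> F k" for k
    using step th_pow_space by (auto simp: F_def)
  have "(\<lambda>k. prob (F k)) \<longlonglongrightarrow> prob (\<Inter>k. F k)"
    by (rule finite_Lim_measure_decseq) (auto simp: decseq_Suc_iff dec)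
  moreover have "prob (F k) = prob E" for k
    unfolding F_def by (rule prob_th_pow) measurable
  ultimately have eq: "prob (\<Inter>k. F k) = prob E"
    by (simp add: LIMSEQ_const_iff)
  have "th -` (\<Inter>k. F k) \<inter> space M = (\<Inter>k. F (Suc k))"
    using measurable_space[OF th_measurable] by (auto simp: F_def funpow_swap1)
  also have "\<dots> = (\<Inter>k. F k)"
    using dec by blast
  finally have "prob (\<Inter>k. F k) = 0 \<or> prob (\<Inter>k. F k) = 1"
    by (intro ergodic) auto
  moreover have "prob E \<noteq> 1"
  proof
    assume "prob E = 1"
    then have "AE x in M. x \<in> E" by (simp add: prob_eq_1)
    then have "AE x in M. \<exists>n\<ge>1. a * real n \<le> f n x"
    proof eventually_elim
      case (elim x)
      then have x: "x \<in> space M" by (simp add: E_def)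
      have f0: "f 0 x \<le> 0" using superadd[OF x, of 0 0] by simp
      obtain n where "f n x > a * real n + real (0::nat)"
        using elim unfolding E_def by blast
      moreover from this f0 have "n \<noteq> 0" by (intro notI) simp
      ultimately show ?case by (intro exI[of _ n]) auto
    qed
    then have "a \<le> l"
      using superadditive_growth_le[OF int nonneg superadd mean a0] by blast
    then show False using a by simp
  qed
  ultimately have "prob E = 0" using eq by simp
  then have "AE x in M. x \<notin> E" by (simp add: prob_eq_0)
  with AE_space show ?thesis
    by eventually_elim (auto simp: E_def not_less)
qed

text \<open>
  The sums of \<open>b - \<phi>\<close> are nonnegative and additive, so an upper bound for their growth is a
  lower bound for the growth of the sums of \<open>\<phi>\<close>.
\<close>
corollary birkhoff_lower:
  fixes \<phi> :: "'a \<Rightarrow> real"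
  assumes [measurable]: "\<phi> \<in> borel_measurable M"
    and bound: "\<And>x. x \<in> space M \<Longrightarrow> norm (\<phi> x) \<le> b"
    and a: "a < expectation \<phi>"
  shows "AE x in M. \<exists>c. \<forall>n. a * real n - c \<le> (\<Sum>j<n. \<phi> ((th ^^ j) x))"
proof -
  let ?f = "\<lambda>n x. \<Sum>j<n. b - \<phi> ((th ^^ j) x)"
  have int: "integrable M (\<lambda>x. \<phi> ((th ^^ j) x))" for j
  proof (rule integrable_const_bound)
    show "AE x in M. norm (\<phi> ((th ^^ j) x)) \<le> b"
      by (rule AE_I2) (rule bound[OF th_pow_space])
    show "(\<lambda>x. \<phi> ((th ^^ j) x)) \<in> borel_measurable M"
      by (rule measurable_compose[OF th_pow_measurable]) fact
  qed
  have "AE x in M. \<exists>c. \<forall>n. ?f n x \<le> (b - a) * real n + c"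
  proof (rule superadditive_upper[where l = "b - expectation \<phi>"])
    show "integrable M (?f n)" for n by (rule Bochner_Integration.integrable_sum, rule Bochner_Integration.integrable_diff, rule integrable_const, rule int)
    show "0 \<le> ?f n x" if "x \<in> space M" for n x
      using bound[OF th_pow_space[OF that]] by (intro sum_nonneg) (auto simp: abs_le_iff)
    show "?f s x + ?f t ((th ^^ s) x) \<le> ?f (s + t) x" for s t x
    proof -
      have "(th ^^ j) ((th ^^ s) x) = (th ^^ (s + j)) x" for j
        by (simp add: funpow_add add.commute[of s])
      then have "?f (s + t) x = ?f s x + ?f t ((th ^^ s) x)"
        by (induction t) (simp_all only: add_0_right add_Suc_right sum.lessThan_Suc sum.empty lessThan_0 add.assoc)
      then show ?thesis by simp
    qed
    show "expectation (?f n) \<le> real n * (b - expectation \<phi>)" for n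
    proof -
      have "expectation (?f n) = (\<Sum>j<n. expectation (\<lambda>x. b - \<phi> ((th ^^ j) x)))"
        by (rule Bochner_Integration.integral_sum, rule Bochner_Integration.integrable_diff,
            rule integrable_const, rule int)
      also have "\<dots> = (\<Sum>j<n. b - expectation \<phi>)"
        by (simp only: Bochner_Integration.integral_diff[OF integrable_const int]
            expectation_th_pow[OF assms(1)] lebesgue_integral_const prob_space) simp
      finally show ?thesis by simp
    qed
  qed (use a in simp)
  then show ?thesis
  proof eventually_elim
    case (elim x)
    then obtain c where c: "\<And>n. ?f n x \<le> (b - a) * real n + c" by blast
    show ?case
      by (rule exI[of _ c]) (use c in \<open>simp add: sum_subtractf algebra_simps\<close>)
  qed
qed

end

text \<open>
  An event that is invariant under the shift does not depend on any initial segment of the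
  coordinates, so it is a tail event and Kolmogorov's zero-one law applies.
\<close>
lemma ergodic_shift:
  assumes "prob_space D"
  shows "ergodic_system (\<Pi>\<^sub>M i\<in>UNIV. D) (\<lambda>x :: nat \<Rightarrow> 'a. \<lambda>i. x (Suc i))"
proof -
  interpret D: prob_space D by fact
  let ?P = "\<Pi>\<^sub>M i\<in>(UNIV :: nat set). D"
  let ?th = "\<lambda>x :: nat \<Rightarrow> 'a. \<lambda>i. x (Suc i)"
  interpret P: prob_space ?P by (intro prob_space_PiM assms)
  have th [measurable]: "?th \<in> measurable ?P ?P"
    by (rule measurable_PiM_single') (auto simp: space_PiM)
  have pow: "(?th ^^ n) x = (\<lambda>i. x (i + n))" for n x
    by (induction n arbitrary: x) (auto simp: fun_eq_iff)
  show ?thesis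
  proof unfold_locales
    show "?th \<in> measurable ?P ?P" by (rule th)
    show "distr ?P ?P ?th = ?P"
      using distr_PiM_reindex[of UNIV "\<lambda>_. D" Suc UNIV] assms by (simp add: restrict_def)
  next
    fix A assume A: "A \<in> sets ?P" and inv: "?th -` A \<inter> space ?P = A"
    define F where "F i = {(\<lambda>x. x i) -` B \<inter> space ?P | B. B \<in> sets D}" for i :: nat
    have sa: "sigma_algebra (space ?P) (F i)" for i
      using sets.sigma_algebra_axioms[of "vimage_algebra (space ?P) (\<lambda>x. x i) D"]
      by (subst (asm) sets_vimage_algebra2) (auto simp: F_def space_PiM)
    show "P.prob A = 0 \<or> P.prob A = 1"
    proof (rule P.kolmogorov_0_1_law[of F])
      show "sigma_algebra (space ?P) (F i)" for i by (rule sa)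
      have "P.indep_vars (\<lambda>_. D) (\<lambda>i x. x i) UNIV"
      proof (subst P.indep_vars_iff_distr_eq_PiM')
        have "distr ?P D (\<lambda>x. x i) = D" for i
          by (rule distr_PiM_component) (use assms in auto)
        then show "distr ?P (\<Pi>\<^sub>M i\<in>UNIV. D) (\<lambda>x. \<lambda>i\<in>UNIV. x i) = (\<Pi>\<^sub>M i\<in>UNIV. distr ?P D (\<lambda>x. x i))"
          by (simp add: restrict_def distr_id2 cong: PiM_cong)
      qed auto
      then show "P.indep_sets F UNIV"
        unfolding P.indep_vars_def2 F_def by simp
      have "A \<in> sigma_sets (space ?P) (\<Union>i\<in>{n..}. F i)" for n
      proof -
        let ?S = "sigma (space ?P) (\<Union>i\<in>{n..}. F i)"
        have sub: "(\<Union>i\<in>{n..}. F i) \<subseteq> Pow (space ?P)" by (auto simp: F_def)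
        \<comment> \<open>The \<open>n\<close>-fold shift is measurable for the coordinates from \<open>n\<close> on, and \<open>A\<close> is its own preimage.\<close>
        have coord: "(\<lambda>x. x (i + n)) \<in> measurable ?S D" for i
        proof (rule measurableI)
          fix x assume "x \<in> space ?S"
          then show "x (i + n) \<in> space D" using sub by (auto simp: space_measure_of_conv space_PiM)
        next
          fix B assume "B \<in> sets D"
          then have "(\<lambda>x. x (i + n)) -` B \<inter> space ?P \<in> (\<Union>i\<in>{n..}. F i)"
            by (auto simp: F_def intro!: bexI[of _ "i + n"])
          then show "(\<lambda>x. x (i + n)) -` B \<inter> space ?S \<in> sets ?S"
            using sub by (auto simp: space_measure_of_conv sets_measure_of_conv)
        qed
        have "(\<lambda>x i. x (i + n)) \<in> measurable ?S ?P"
        proof (rule measurable_PiM_single')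
          show "(\<lambda>x. x (i + n)) \<in> measurable ?S D" for i by (rule coord)
          show "(\<lambda>x i. x (i + n)) \<in> space ?S \<rightarrow> (\<Pi>\<^sub>E i\<in>UNIV. space D)"
            by (auto simp: space_measure_of_conv space_PiM)
        qed
        then have "(\<lambda>x i. x (i + n)) -` A \<inter> space ?S \<in> sets ?S"
          using A by (rule measurable_sets)
        moreover have "(\<lambda>x i. x (i + n)) -` A \<inter> space ?P = A"
        proof -
          have "(?th ^^ n) -` A \<inter> space ?P = A"
          proof (induction n)
            case 0
            then show ?case using sets.sets_into_space[OF A] by auto
          next
            case (Suc n)
            have "(?th ^^ Suc n) -` A \<inter> space ?P = (?th ^^ n) -` (?th -` A \<inter> space ?P) \<inter> space ?P"
              unfolding pow by (auto simp: space_PiM)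
            then show ?case by (simp only: Suc inv)
          qed
          then show ?thesis unfolding pow .
        qed
        ultimately show ?thesis
          using sub by (simp add: space_measure_of_conv sets_measure_of_conv)
      qed
      then show "A \<in> P.tail_events F" by (auto simp: P.tail_events_def)
    qed
  qed
qed

section \<open>The Loewner order and matrix inverses\<close>

definition loewner_le :: "real^'n^'n \<Rightarrow> real^'n^'n \<Rightarrow> bool" (infix "\<preceq>" 50) where
  "X \<preceq> Y \<longleftrightarrow> psd_matrix (Y - X)"

lemma psd_matrixI: "transpose X = X \<Longrightarrow> (\<And>x. 0 \<le> x \<bullet> (X *v x)) \<Longrightarrow> psd_matrix X"
  by (simp add: psd_matrix_def)

lemma psd_nonneg: "psd_matrix X \<Longrightarrow> 0 \<le> x \<bullet> (X *v x)"
  by (simp add: psd_matrix_def)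

lemma psd_symmetric: "psd_matrix X \<Longrightarrow> transpose X = X"
  by (simp add: psd_matrix_def)

lemma pd_symmetric: "pd_matrix X \<Longrightarrow> transpose X = X"
  by (simp add: pd_matrix_def)

lemma pd_imp_psd: "pd_matrix X \<Longrightarrow> psd_matrix X"
  unfolding pd_matrix_def psd_matrix_def by (metis inner_zero_left less_eq_real_def)

lemma transpose_plus: "transpose (X + Y :: real^'n^'m) = transpose X + transpose Y"
  by (simp add: transpose_def vec_eq_iff)

lemma transpose_minus: "transpose (X - Y :: real^'n^'m) = transpose X - transpose Y"
  by (simp add: transpose_def vec_eq_iff)

lemma transpose_scale: "transpose (a *\<^sub>R X :: real^'n^'m) = a *\<^sub>R transpose X"
  by (simp add: transpose_def vec_eq_iff)

lemma inner_symmetric_matrix: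
  fixes X :: "real^'n^'n"
  assumes "transpose X = X"
  shows "(X *v x) \<bullet> y = x \<bullet> (X *v y)"
  by (metis assms dot_lmul_matrix transpose_matrix_vector)

lemma psd_zero: "psd_matrix 0"
  by (simp add: psd_matrix_def transpose_def vec_eq_iff)

lemma psd_add: "psd_matrix X \<Longrightarrow> psd_matrix Y \<Longrightarrow> psd_matrix (X + Y)"
  by (simp add: psd_matrix_def transpose_plus matrix_vector_mult_add_rdistrib inner_add_right)

lemma pd_add_psd: "pd_matrix X \<Longrightarrow> psd_matrix Y \<Longrightarrow> pd_matrix (X + Y)"
  by (simp add: psd_matrix_def pd_matrix_def transpose_plus matrix_vector_mult_add_rdistrib
      inner_add_right add_pos_nonneg)

lemma psd_scale: "0 \<le> a \<Longrightarrow> psd_matrix X \<Longrightarrow> psd_matrix (a *\<^sub>R X)"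
  by (simp add: psd_matrix_def transpose_scale scaleR_matrix_vector_assoc[symmetric])

lemma pd_scale: "0 < a \<Longrightarrow> pd_matrix X \<Longrightarrow> pd_matrix (a *\<^sub>R X)"
  by (simp add: pd_matrix_def transpose_scale scaleR_matrix_vector_assoc[symmetric])

lemma psd_sum: "(\<And>i. i \<in> I \<Longrightarrow> psd_matrix (X i)) \<Longrightarrow> psd_matrix (\<Sum>i\<in>I. X i)"
  by (induction I rule: infinite_finite_induct) (auto simp: psd_zero psd_add)

lemma transpose_congruence:
  fixes X :: "real^'n^'n" and B :: "real^'n^'m"
  shows "transpose X = X \<Longrightarrow> transpose (B ** X ** transpose B) = B ** X ** transpose B"
  by (simp add: matrix_transpose_mul matrix_mul_assoc)

lemma quadratic_congruence:
  fixes X :: "real^'n^'n" and B :: "real^'n^'m"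
  shows "x \<bullet> (B ** X ** transpose B *v x) = (transpose B *v x) \<bullet> (X *v (transpose B *v x))"
  by (simp add: matrix_vector_mul_assoc[symmetric] dot_lmul_matrix)

lemma psd_congruence: "psd_matrix X \<Longrightarrow> psd_matrix (B ** X ** transpose B)"
  for X :: "real^'n^'n" and B :: "real^'n^'m"
  by (intro psd_matrixI) (simp_all only: transpose_congruence quadratic_congruence psd_symmetric psd_nonneg)

lemma psd_gram:
  fixes B :: "real^'n^'m"
  shows "psd_matrix (transpose B ** B)"
proof -
  have "psd_matrix (mat 1 :: real^'m^'m)"
    by (simp add: psd_matrix_def transpose_mat)
  from psd_congruence[OF this, of "transpose B"] show ?thesis by simp
qed

lemma loewner_trans: "X \<preceq> Y \<Longrightarrow> Y \<preceq> Z \<Longrightarrow> X \<preceq> Z"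
  unfolding loewner_le_def using psd_add[of "Y - X" "Z - Y"] by simp

lemma zero_loewner: "0 \<preceq> X \<longleftrightarrow> psd_matrix X"
  by (simp add: loewner_le_def)

lemma loewner_add_right: "X \<preceq> Y \<Longrightarrow> X + Z \<preceq> Y + Z"
  by (simp add: loewner_le_def)

lemma loewner_scale: "0 \<le> a \<Longrightarrow> X \<preceq> Y \<Longrightarrow> a *\<^sub>R X \<preceq> a *\<^sub>R Y"
  unfolding loewner_le_def by (simp add: scaleR_diff_right[symmetric] psd_scale)

lemma loewner_scale_left: "a \<le> b \<Longrightarrow> psd_matrix X \<Longrightarrow> a *\<^sub>R X \<preceq> b *\<^sub>R X"
  unfolding loewner_le_def by (simp add: scaleR_diff_left[symmetric] psd_scale)

lemma loewner_quadratic: "X \<preceq> Y \<Longrightarrow> x \<bullet> (X *v x) \<le> x \<bullet> (Y *v x)"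
  unfolding loewner_le_def
  using psd_nonneg[of "Y - X" x] by (simp add: matrix_vector_mult_diff_rdistrib inner_diff_right)

lemma loewnerI:
  assumes "transpose X = X" "transpose Y = Y" "\<And>x. x \<bullet> (X *v x) \<le> x \<bullet> (Y *v x)"
  shows "X \<preceq> Y"
  using assms
  by (auto simp: loewner_le_def psd_matrix_def transpose_minus matrix_vector_mult_diff_rdistrib inner_diff_right)

lemma loewner_congruence:
  fixes X Y :: "real^'n^'n" and B :: "real^'n^'m"
  assumes "psd_matrix X" "psd_matrix Y" "X \<preceq> Y"
  shows "B ** X ** transpose B \<preceq> B ** Y ** transpose B"
  using assms
  by (intro loewnerI)
     (simp_all only: transpose_congruence quadratic_congruence psd_symmetric loewner_quadratic)

lemma trace_eq_sum_quadratic: "trace X = (\<Sum>i\<in>UNIV. axis i 1 \<bullet> (X *v axis i 1))"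
  for X :: "real^'n^'n"
  by (simp add: trace_def inner_axis_axis inner_axis' matrix_vector_mult_basis column_def)

lemma trace_mono: "X \<preceq> Y \<Longrightarrow> trace X \<le> trace Y"
  by (simp add: trace_eq_sum_quadratic sum_mono loewner_quadratic)

lemma trace_psd_nonneg: "psd_matrix X \<Longrightarrow> 0 \<le> trace X"
  by (simp add: trace_eq_sum_quadratic sum_nonneg psd_nonneg)

lemma trace_scale: "trace (a *\<^sub>R X) = a * trace X" for X :: "real^'n^'n"
  by (simp add: trace_def sum_distrib_left)

lemma pd_invertible:
  fixes X :: "real^'n^'n"
  assumes "pd_matrix X"
  shows "invertible X"
proof -
  have "inj ((*v) X)"
  proof (rule injI)
    fix x y assume "X *v x = X *v y"
    then have "(x - y) \<bullet> (X *v (x - y)) = 0" by (simp add: matrix_vector_mult_diff_distrib)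
    then show "x = y" using assms unfolding pd_matrix_def by (metis eq_iff_diff_eq_0 less_irrefl)
  qed
  then show ?thesis
    by (metis invertible_left_inverse matrix_left_invertible_injective)
qed

lemma matrix_inv_inverse:
  fixes X :: "real^'n^'n"
  assumes "invertible X"
  shows "X ** matrix_inv X = mat 1" "matrix_inv X ** X = mat 1"
proof -
  have "\<exists>Y. X ** Y = mat 1 \<and> Y ** X = mat 1" using assms by (simp add: invertible_def)
  from someI_ex[OF this] show "X ** matrix_inv X = mat 1" "matrix_inv X ** X = mat 1"
    unfolding matrix_inv_def by blast+
qed

lemma matrix_inv_eqI:
  fixes X Y :: "real^'n^'n"
  assumes "X ** Y = mat 1"
  shows "matrix_inv X = Y"
proof -
  have "invertible X" using assms by (auto simp: invertible_right_inverse)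
  have "matrix_inv X = matrix_inv X ** (X ** Y)" by (simp add: assms)
  also have "\<dots> = Y" using matrix_inv_inverse(2)[OF \<open>invertible X\<close>] by (simp add: matrix_mul_assoc)
  finally show ?thesis .
qed

lemma pd_inverse_apply:
  assumes "pd_matrix X"
  shows "X *v (matrix_inv X *v x) = x" "matrix_inv X *v (X *v x) = x"
  using matrix_inv_inverse[OF pd_invertible[OF assms]]
  by (simp_all add: matrix_vector_mul_assoc)

lemma transpose_matrix_inv:
  fixes X :: "real^'n^'n"
  assumes "invertible X"
  shows "transpose (matrix_inv X) = matrix_inv (transpose X)"
proof (rule matrix_inv_eqI[symmetric])
  show "transpose X ** transpose (matrix_inv X) = mat 1"
    using matrix_inv_inverse[OF assms] by (simp_all add: matrix_transpose_mul[symmetric] transpose_mat)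
qed

lemma pd_matrix_inv:
  fixes X :: "real^'n^'n"
  assumes "pd_matrix X"
  shows "pd_matrix (matrix_inv X)"
  unfolding pd_matrix_def
proof (intro conjI allI impI)
  show "transpose (matrix_inv X) = matrix_inv X"
    using transpose_matrix_inv[OF pd_invertible[OF assms]] pd_symmetric[OF assms] by simp
  fix x :: "real^'n" assume "x \<noteq> 0"
  let ?y = "matrix_inv X *v x"
  have "?y \<noteq> 0" using \<open>x \<noteq> 0\<close> pd_inverse_apply(1)[OF assms, of x] by auto
  then have "0 < ?y \<bullet> (X *v ?y)" using assms by (simp add: pd_matrix_def)
  then show "0 < x \<bullet> ?y" by (simp add: pd_inverse_apply[OF assms] inner_commute)
qed

lemma pd_loewner: "pd_matrix X \<Longrightarrow> X \<preceq> Y \<Longrightarrow> pd_matrix Y"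
  unfolding loewner_le_def using pd_add_psd[of X "Y - X"] by simp

text \<open>
  The quadratic form of the inverse is the maximum over \<open>z\<close> of the expression on the left,
  attained at \<open>z = matrix_inv X *v x\<close>.  This variational description yields the antitonicity of the
  inverse without matrix square roots or diagonalization.
\<close>
lemma pd_inverse_variational:
  fixes X :: "real^'n^'n"
  assumes "pd_matrix X"
  shows "2 * (x \<bullet> z) - z \<bullet> (X *v z) \<le> x \<bullet> (matrix_inv X *v x)"
proof -
  let ?y = "matrix_inv X *v x"
  have "0 \<le> (z - ?y) \<bullet> (X *v (z - ?y))"
    by (rule psd_nonneg[OF pd_imp_psd[OF assms]])
  also have "\<dots> = z \<bullet> (X *v z) - z \<bullet> x - ?y \<bullet> (X *v z) + ?y \<bullet> x"
    by (simp add: matrix_vector_mult_diff_distrib inner_diff_left inner_diff_right pd_inverse_apply[OF assms])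
  also have "?y \<bullet> (X *v z) = x \<bullet> z"
    using inner_symmetric_matrix[OF pd_symmetric[OF assms], of ?y z] by (simp add: pd_inverse_apply[OF assms])
  finally show ?thesis by (simp add: inner_commute)
qed

lemma matrix_inv_antimono:
  fixes X Y :: "real^'n^'n"
  assumes X: "pd_matrix X" and le: "X \<preceq> Y"
  shows "matrix_inv Y \<preceq> matrix_inv X"
proof (rule loewnerI)
  have Y: "pd_matrix Y" by (rule pd_loewner[OF X le])
  show "transpose (matrix_inv Y) = matrix_inv Y" "transpose (matrix_inv X) = matrix_inv X"
    by (intro pd_symmetric pd_matrix_inv X Y)+
  fix x
  let ?z = "matrix_inv Y *v x"
  have "x \<bullet> ?z = 2 * (x \<bullet> ?z) - ?z \<bullet> (Y *v ?z)"
    by (simp add: pd_inverse_apply[OF Y] inner_commute)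
  also have "\<dots> \<le> 2 * (x \<bullet> ?z) - ?z \<bullet> (X *v ?z)"
    using loewner_quadratic[OF le] by simp
  also have "\<dots> \<le> x \<bullet> (matrix_inv X *v x)"
    by (rule pd_inverse_variational[OF X])
  finally show "x \<bullet> ?z \<le> x \<bullet> (matrix_inv X *v x)" .
qed

lemma matrix_inv_scale:
  fixes X :: "real^'n^'n"
  assumes "pd_matrix X" "0 < a"
  shows "matrix_inv (a *\<^sub>R X) = (1 / a) *\<^sub>R matrix_inv X"
  using matrix_inv_inverse[OF pd_invertible[OF assms(1)]] assms(2)
  by (intro matrix_inv_eqI) (simp add: scalar_matrix_assoc[symmetric] matrix_scalar_ac)

text \<open>The covariance update by a measurement that contributes the information matrix \<open>R\<close>.\<close>
definition inform :: "real^'n^'n \<Rightarrow> real^'n^'n \<Rightarrow> real^'n^'n" where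
  "inform R V = matrix_inv (matrix_inv V + R)"

lemma inform_pd: "psd_matrix R \<Longrightarrow> pd_matrix V \<Longrightarrow> pd_matrix (inform R V)"
  unfolding inform_def by (intro pd_matrix_inv pd_add_psd)

lemma inform_mono:
  assumes R: "psd_matrix R" and V: "pd_matrix V" and le: "V \<preceq> W"
  shows "inform R V \<preceq> inform R W"
  unfolding inform_def
  by (intro matrix_inv_antimono loewner_add_right le pd_add_psd pd_matrix_inv pd_loewner[OF V le] R V)

text \<open>
  Scaling \<open>V\<close> by \<open>a \<ge> 1\<close> divides its inverse by \<open>a\<close>, while the information \<open>R\<close> keeps its full
  weight; the result is therefore at most \<open>a\<close> times the original update.
\<close>
lemma inform_scale:
  assumes R: "psd_matrix R" and V: "pd_matrix V" and W: "pd_matrix W"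
    and le: "W \<preceq> a *\<^sub>R V" and a: "1 \<le> a"
  shows "inform R W \<preceq> a *\<^sub>R inform R V"
proof -
  have inv: "inform R (a *\<^sub>R V) = matrix_inv ((1 / a) *\<^sub>R matrix_inv V + R)"
    using a V by (simp add: inform_def matrix_inv_scale)
  have "(1 / a) *\<^sub>R (matrix_inv V + R) \<preceq> (1 / a) *\<^sub>R matrix_inv V + R"
  proof -
    have "(1 / a) *\<^sub>R R \<preceq> 1 *\<^sub>R R" using a by (intro loewner_scale_left R) simp
    from loewner_add_right[OF this, of "(1 / a) *\<^sub>R matrix_inv V"] show ?thesis
      by (simp add: scaleR_add_right add.commute)
  qed
  moreover have p: "pd_matrix (matrix_inv V + R)" by (intro pd_add_psd pd_matrix_inv R V)
  ultimately have "inform R (a *\<^sub>R V) \<preceq> matrix_inv ((1 / a) *\<^sub>R (matrix_inv V + R))"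
    unfolding inv using a by (intro matrix_inv_antimono pd_scale) auto
  also have "matrix_inv ((1 / a) *\<^sub>R (matrix_inv V + R)) = a *\<^sub>R inform R V"
    using a p by (simp add: matrix_inv_scale inform_def)
  finally show ?thesis
    using inform_mono[OF R W le] loewner_trans by blast
qed

lemma pd_quadratic_lower_bound:
  fixes Q :: "real^'n^'n"
  assumes "pd_matrix Q"
  obtains q where "0 < q" "\<And>x. q * (x \<bullet> x) \<le> x \<bullet> (Q *v x)"
proof -
  have cont: "continuous_on S (\<lambda>x. x \<bullet> (Q *v x))" for S
    by (intro continuous_intros linear_continuous_on_compose matrix_vector_mul_linear) 
  \<comment> \<open>The constant is the minimum of the quadratic form on the unit sphere.\<close>
  have "sphere 0 1 \<noteq> ({} :: (real^'n) set)" by simp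
  then obtain u where u: "norm u = 1" "\<And>x. norm x = 1 \<Longrightarrow> u \<bullet> (Q *v u) \<le> x \<bullet> (Q *v x)"
    using continuous_attains_inf[OF compact_sphere _ cont, of 0 1] by auto
  have pos: "0 < u \<bullet> (Q *v u)" using assms u(1) unfolding pd_matrix_def by (metis norm_zero zero_neq_one)
  have "u \<bullet> (Q *v u) * (x \<bullet> x) \<le> x \<bullet> (Q *v x)" for x
  proof (cases "x = 0")
    case False
    let ?y = "(1 / norm x) *\<^sub>R x"
    have "u \<bullet> (Q *v u) \<le> ?y \<bullet> (Q *v ?y)" using False by (intro u(2)) simp
    also have "\<dots> = x \<bullet> (Q *v x) / (x \<bullet> x)"
      using False by (simp add: matrix_vector_mult_scaleR dot_square_norm power2_eq_square)
    finally show ?thesis using False by (simp add: field_simps)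
  qed simp
  with pos show thesis using that by blast
qed

lemma psd_quadratic_le_trace:
  fixes X :: "real^'n^'n"
  assumes "psd_matrix X"
  shows "x \<bullet> (X *v x) \<le> trace X * (x \<bullet> x)"
proof -
  have sym: "X $ j $ i = X $ i $ j" for i j
  proof -
    have "transpose X $ i $ j = X $ i $ j" using psd_symmetric[OF assms] by simp
    then show ?thesis by (simp add: transpose_def)
  qed
  \<comment> \<open>Test positivity on the vector \<open>x\<^sub>j e\<^sub>i - x\<^sub>i e\<^sub>j\<close> and sum over all pairs of indices.\<close>
  have pair: "2 * (x $ i * x $ j * X $ i $ j) \<le> (x $ j)\<^sup>2 * X $ i $ i + (x $ i)\<^sup>2 * X $ j $ j" for i j
  proof -
    let ?v = "(x $ j) *\<^sub>R axis i 1 - (x $ i) *\<^sub>R axis j 1 :: real^'n"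
    have entry: "axis k 1 \<bullet> (X *v axis l 1) = X $ k $ l" for k l
      by (simp add: inner_axis' matrix_vector_mult_basis column_def)
    have "0 \<le> ?v \<bullet> (X *v ?v)" by (rule psd_nonneg[OF assms])
    then show ?thesis
      by (simp add: matrix_vector_mult_diff_distrib matrix_vector_mult_scaleR inner_diff_left
          inner_diff_right entry sym[of i j] power2_eq_square algebra_simps)
  qed
  have quad: "x \<bullet> (X *v x) = (\<Sum>i\<in>UNIV. \<Sum>j\<in>UNIV. x $ i * x $ j * X $ i $ j)"
    by (simp add: inner_vec_def matrix_vector_mult_def sum_distrib_left mult_ac)
  have "2 * (x \<bullet> (X *v x)) = (\<Sum>i\<in>UNIV. \<Sum>j\<in>UNIV. 2 * (x $ i * x $ j * X $ i $ j))"
    by (simp add: quad sum_distrib_left)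
  also have "\<dots> \<le> (\<Sum>i\<in>UNIV. \<Sum>j\<in>UNIV. (x $ j)\<^sup>2 * X $ i $ i + (x $ i)\<^sup>2 * X $ j $ j)"
    by (intro sum_mono pair)
  also have "\<dots> = 2 * (trace X * (x \<bullet> x))"
    by (simp add: sum.distrib trace_def inner_vec_def power2_eq_square
        sum_distrib_left[symmetric] sum_distrib_right[symmetric] mult.commute)
  finally show ?thesis by simp
qed

lemma psd_dominated:
  fixes Q :: "real^'n^'n"
  assumes "pd_matrix Q"
  obtains b where "0 \<le> b" "\<And>X. psd_matrix X \<Longrightarrow> X \<preceq> (b * trace X) *\<^sub>R Q"
proof -
  obtain q where q: "0 < q" "\<And>x. q * (x \<bullet> x) \<le> x \<bullet> (Q *v x)"
    using pd_quadratic_lower_bound[OF assms] by blast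
  have "X \<preceq> (1 / q * trace X) *\<^sub>R Q" if X: "psd_matrix X" for X
  proof (rule loewnerI)
    fix x
    have "x \<bullet> (X *v x) \<le> trace X * (x \<bullet> x)" by (rule psd_quadratic_le_trace[OF X])
    also have "\<dots> = (trace X / q) * (q * (x \<bullet> x))" using q(1) by simp
    also have "\<dots> \<le> (trace X / q) * (x \<bullet> (Q *v x))"
      using q trace_psd_nonneg[OF X] by (intro mult_left_mono) auto
    finally show "x \<bullet> (X *v x) \<le> x \<bullet> ((1 / q * trace X) *\<^sub>R Q *v x)"
      by (simp add: scaleR_matrix_vector_assoc[symmetric])
  qed (use X assms in \<open>simp_all add: psd_symmetric pd_symmetric transpose_scale\<close>)
  with q(1) show thesis using that[of "1 / q"] by simp
qed

section \<open>Iterated random monotone maps\<close>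

lemma shift_pow: "((\<lambda>x i. x (Suc i)) ^^ n) (t :: nat \<Rightarrow> 'a) = (\<lambda>i. t (n + i))"
  by (induction n arbitrary: t) (auto simp: fun_eq_iff)

text \<open>The cocycle over the shift generated by \<open>h\<close>; \<open>cocycle_add\<close> below is its cocycle identity.\<close>
primrec cocycle :: "('b \<Rightarrow> 'a \<Rightarrow> 'a) \<Rightarrow> nat \<Rightarrow> (nat \<Rightarrow> 'b) \<Rightarrow> 'a \<Rightarrow> 'a" where
  "cocycle h 0 t X = X"
| "cocycle h (Suc k) t X = h (t k) (cocycle h k t X)"

lemma cocycle_add: "cocycle h (m + n) t X = cocycle h n (\<lambda>i. t (m + i)) (cocycle h m t X)"
  by (induction n) auto

lemma eventually_average_gt:
  fixes U :: "nat \<Rightarrow> real"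
  assumes "eventually (\<lambda>N. a * real N - c \<le> U N) sequentially" "z < a"
  shows "eventually (\<lambda>N. z < 1 / real N * U N) sequentially"
proof -
  have "(\<lambda>N. c / real N) \<longlonglongrightarrow> 0" by (rule lim_const_over_n)
  then have "eventually (\<lambda>N. c / real N < a - z) sequentially"
    using assms(2) by (intro order_tendstoD) auto
  with assms(1) eventually_gt_at_top[of 0] show ?thesis
    by eventually_elim (auto simp: field_simps)
qed

lemma eventually_average_lt:
  fixes U :: "nat \<Rightarrow> real"
  assumes "eventually (\<lambda>N. U N \<le> a * real N + c) sequentially" "a < z"
  shows "eventually (\<lambda>N. 1 / real N * U N < z) sequentially"
  using eventually_average_gt[of "- a" c "\<lambda>N. - U N" "- z"] assms
  by (auto simp: algebra_simps elim: eventually_mono)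

text \<open>
  Iteration of randomly selected monotone maps on the cone of positive semidefinite matrices.  The
  last two assumptions compare two starting points multiplicatively: after one step
  every orbit lies below a multiple of the orbit of \<open>0\<close>, and the excess \<open>a - 1\<close> of such
  a multiple over \<open>1\<close> shrinks, uniformly as long as the lower orbit has bounded trace.
\<close>
locale random_iteration =
  fixes D :: "'b measure" and h :: "'b \<Rightarrow> real^'n^'n \<Rightarrow> real^'n^'n"
  assumes prob_D: "prob_space D"
    and finite_D: "finite (space D)"
    and sets_D: "sets D = Pow (space D)"
    and h_psd: "\<And>T X. T \<in> space D \<Longrightarrow> psd_matrix X \<Longrightarrow> psd_matrix (h T X)"
    and h_mono: "\<And>T X Y. T \<in> space D \<Longrightarrow> psd_matrix X \<Longrightarrow> psd_matrix Y \<Longrightarrow> X \<preceq> Y \<Longrightarrow> h T X \<preceq> h T Y"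
    and h_contract: "\<And>b. \<exists>\<rho>. 0 \<le> \<rho> \<and> \<rho> < 1 \<and> (\<forall>T X Y a. T \<in> space D \<longrightarrow> psd_matrix X \<longrightarrow>
      psd_matrix Y \<longrightarrow> trace X \<le> b \<longrightarrow> 1 \<le> a \<longrightarrow> Y \<preceq> a *\<^sub>R X \<longrightarrow>
      h T Y \<preceq> (1 + \<rho> * (a - 1)) *\<^sub>R h T X)"
    and h_start: "\<And>X. psd_matrix X \<Longrightarrow> \<exists>a\<ge>1. \<forall>T\<in>space D. h T X \<preceq> a *\<^sub>R h T 0"
begin

abbreviation seq :: "(nat \<Rightarrow> 'b) measure" where
  "seq \<equiv> \<Pi>\<^sub>M i\<in>UNIV. D"

sublocale ergodic_system seq "\<lambda>x i. x (Suc i)"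
  by (rule ergodic_shift[OF prob_D])

lemma in_D: "t \<in> space seq \<Longrightarrow> t k \<in> space D"
  by (auto simp: space_PiM)

text \<open>
  Finitely many selections are possible at each step, so a function of the \<open>k\<close>-th iterate takes
  finitely many values.  This makes it measurable and integrable whatever the maps \<open>h T\<close> are.
\<close>
lemma finite_range_cocycle: "finite ((\<lambda>t. cocycle h k t X) ` space seq)"
proof (induction k)
  case (Suc k)
  have "(\<lambda>t. cocycle h (Suc k) t X) ` space seq
    \<subseteq> (\<lambda>(T, Y). h T Y) ` (space D \<times> (\<lambda>t. cocycle h k t X) ` space seq)"
    using in_D by fastforce
  then show ?case using Suc finite_D by (meson finite_SigmaI finite_imageI finite_subset)
qed (rule finite_subset[of _ "{X}"], auto)

lemma measurable_cocycle: "(\<lambda>t. \<phi> (cocycle h k t X)) \<in> borel_measurable seq"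
proof (induction k arbitrary: \<phi>)
  case (Suc k)
  have "(\<lambda>t. t k) \<in> measurable seq (count_space (space D))"
  proof -
    have "sets D = sets (count_space (space D))" using sets_D by simp
    then show ?thesis by (subst measurable_cong_sets[OF refl, of _ D]) auto
  qed
  then have "(\<lambda>t. (\<lambda>T. \<phi> (h T (cocycle h k t X))) (t k)) \<in> borel_measurable seq"
    by (rule measurable_compose_countable'[rotated]) (auto intro: Suc countable_finite finite_D)
  then show ?case by simp
qed simp

lemma integrable_cocycle:
  fixes \<phi> :: "real^'n^'n \<Rightarrow> 'c :: {banach, second_countable_topology}"
  shows "integrable seq (\<lambda>t. \<phi> (cocycle h k t X))"
proof -
  let ?B = "Max ((\<lambda>Y. norm (\<phi> Y)) ` (\<lambda>t. cocycle h k t X) ` space seq)"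
  have "AE t in seq. norm (\<phi> (cocycle h k t X)) \<le> ?B"
    by (rule AE_I2) (intro Max_ge finite_imageI finite_range_cocycle imageI)
  then show ?thesis by (rule integrable_const_bound) (rule measurable_cocycle)
qed

lemma cocycle_psd: "(\<And>i. t i \<in> space D) \<Longrightarrow> psd_matrix X \<Longrightarrow> psd_matrix (cocycle h k t X)"
  by (induction k) (auto intro: h_psd)

lemma cocycle_mono:
  assumes "\<And>i. t i \<in> space D" "psd_matrix X" "psd_matrix Y" "X \<preceq> Y"
  shows "cocycle h k t X \<preceq> cocycle h k t Y"
  by (induction k) (auto intro!: h_mono cocycle_psd assms)

lemma h_scale:
  assumes "T \<in> space D" "psd_matrix X" "psd_matrix Y" "1 \<le> a" "Y \<preceq> a *\<^sub>R X"
  shows "h T Y \<preceq> a *\<^sub>R h T X"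
proof -
  obtain \<rho> where \<rho>: "0 \<le> \<rho>" "\<rho> < 1" "h T Y \<preceq> (1 + \<rho> * (a - 1)) *\<^sub>R h T X"
    using h_contract[of "trace X"] assms by blast
  have "\<rho> * (a - 1) \<le> 1 * (a - 1)" using \<rho> assms by (intro mult_right_mono) auto
  then have "(1 + \<rho> * (a - 1)) *\<^sub>R h T X \<preceq> a *\<^sub>R h T X"
    by (intro loewner_scale_left h_psd assms) simp
  with \<rho>(3) show ?thesis by (rule loewner_trans)
qed

definition mean_trace :: "nat \<Rightarrow> real" where
  "mean_trace k = expectation (\<lambda>t. trace (cocycle h k t 0))"

text \<open>
  The covariance reached at time \<open>j\<close> dominates \<open>0\<close>, and the following steps preserve this order.
  Superadditivity of the sums of traces rests on this inequality.
\<close>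
lemma trace_cocycle_shift_le:
  assumes "t \<in> space seq" "psd_matrix X"
  shows "trace (cocycle h k (\<lambda>i. t (j + i)) 0) \<le> trace (cocycle h (j + k) t X)"
  unfolding cocycle_add
  by (intro trace_mono cocycle_mono in_D assms cocycle_psd psd_zero) (simp add: zero_loewner cocycle_psd assms in_D)

lemma trace_cocycle_nonneg: "t \<in> space seq \<Longrightarrow> psd_matrix X \<Longrightarrow> 0 \<le> trace (cocycle h k t X)"
  by (intro trace_psd_nonneg cocycle_psd in_D)

lemma mean_trace_nonneg: "0 \<le> mean_trace k"
  unfolding mean_trace_def
  by (intro integral_nonneg_AE AE_I2 trace_cocycle_nonneg psd_zero)

lemma incseq_mean_trace: "incseq mean_trace"
proof (rule incseq_SucI)
  fix k
  have "mean_trace k = expectation (\<lambda>t. trace (cocycle h k (((\<lambda>x i. x (Suc i)) ^^ 1) t) 0))"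
    unfolding mean_trace_def by (rule expectation_th_pow[symmetric, OF measurable_cocycle])
  also have "\<dots> \<le> mean_trace (Suc k)"
    unfolding mean_trace_def
  proof (rule integral_mono[OF _ integrable_cocycle])
    show "integrable seq (\<lambda>t. trace (cocycle h k (((\<lambda>x i. x (Suc i)) ^^ 1) t) 0))"
      by (rule integrable_distr[OF th_pow_measurable])
         (simp only: th_pow_preserves integrable_cocycle)
    show "trace (cocycle h k (((\<lambda>x i. x (Suc i)) ^^ 1) t) 0) \<le> trace (cocycle h (Suc k) t 0)"
      if "t \<in> space seq" for t
      using trace_cocycle_shift_le[OF that psd_zero, of k 1] by (simp add: shift_pow)
  qed
  finally show "mean_trace k \<le> mean_trace (Suc k)" .
qed

text \<open>
  For fixed \<open>k\<close>, the trace at time \<open>j + k\<close> is at least the bounded function of the \<open>j\<close>-th shift that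
  uses only the last \<open>k\<close> selections, and the averages of the latter are controlled by
  \<open>birkhoff_lower\<close>.
\<close>
lemma trace_sum_lower:
  assumes X: "psd_matrix X" and a: "a < mean_trace k"
  shows "AE t in seq. \<exists>c. eventually (\<lambda>N. a * real N - c \<le> (\<Sum>i=1..N. trace (cocycle h i t X))) sequentially"
proof -
  let ?\<phi> = "\<lambda>t. trace (cocycle h k t 0)"
  obtain b where b: "norm (?\<phi> t) \<le> b" if "t \<in> space seq" for t
  proof
    show "norm (?\<phi> t) \<le> Max ((\<lambda>Y. norm (trace Y)) ` (\<lambda>t. cocycle h k t 0) ` space seq)"
      if "t \<in> space seq" for t
      using that by (intro Max_ge finite_imageI finite_range_cocycle imageI)
  qed
  have "AE t in seq. \<exists>c. \<forall>n. a * real n - c \<le> (\<Sum>j<n. ?\<phi> (((\<lambda>x i. x (Suc i)) ^^ j) t))"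
    by (rule birkhoff_lower[of ?\<phi> b])
       (use a in \<open>auto simp only: mean_trace_def measurable_cocycle b\<close>)
  with AE_space show ?thesis
  proof eventually_elim
    case (elim t)
    then obtain c where c: "\<And>n. a * real n - c \<le> (\<Sum>j<n. ?\<phi> (((\<lambda>x i. x (Suc i)) ^^ j) t))" by blast
    let ?u = "\<lambda>i. trace (cocycle h i t X)"
    have "a * real N - (c + ?u 0 + a * real k) \<le> (\<Sum>i=1..N. ?u i)" if "k \<le> N" for N
    proof -
      have "a * real (N - k) - c \<le> (\<Sum>j<N - k. ?\<phi> (((\<lambda>x i. x (Suc i)) ^^ j) t))" by (rule c)
      also have "\<dots> \<le> (\<Sum>j<N - k. ?u (j + k))"
        unfolding shift_pow by (intro sum_mono trace_cocycle_shift_le elim X)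
      also have "\<dots> = (\<Sum>i\<in>(\<lambda>j. j + k) ` {..<N - k}. ?u i)"
        by (subst sum.reindex) (auto simp: inj_on_def)
      also have "\<dots> \<le> (\<Sum>i=0..N. ?u i)"
        by (intro sum_mono2 trace_cocycle_nonneg elim X) auto
      also have "\<dots> = ?u 0 + (\<Sum>i=1..N. ?u i)"
        by (simp add: sum.atLeast_Suc_atMost)
      finally show ?thesis using that by (simp add: of_nat_diff algebra_simps)
    qed
    then show ?case
      by (intro exI[of _ "c + ?u 0 + a * real k"] eventually_sequentiallyI[of k])
  qed
qed

lemma trace_sum_upper:
  assumes l: "\<And>k. mean_trace k \<le> l" and a: "l < a"
  shows "AE t in seq. \<exists>c. \<forall>N. (\<Sum>i=1..N. trace (cocycle h i t 0)) \<le> a * real N + c"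
proof (rule superadditive_upper[OF _ _ _ _ a])
  show "integrable seq (\<lambda>t. \<Sum>i=1..N. trace (cocycle h i t 0))" for N
    by (intro Bochner_Integration.integrable_sum integrable_cocycle)
  show "0 \<le> (\<Sum>i=1..N. trace (cocycle h i t 0))" if "t \<in> space seq" for N t
    by (intro sum_nonneg trace_cocycle_nonneg that psd_zero)
  show "(\<Sum>i=1..m. trace (cocycle h i t 0))
      + (\<Sum>i=1..n. trace (cocycle h i (((\<lambda>x i. x (Suc i)) ^^ m) t) 0))
    \<le> (\<Sum>i=1..m + n. trace (cocycle h i t 0))" if "t \<in> space seq" for m n t
  proof -
    have "(\<Sum>i=1..n. trace (cocycle h i (((\<lambda>x i. x (Suc i)) ^^ m) t) 0))
      \<le> (\<Sum>i=1..n. trace (cocycle h (m + i) t 0))"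
      unfolding shift_pow by (intro sum_mono trace_cocycle_shift_le that psd_zero)
    also have "\<dots> = (\<Sum>i=m + 1..m + n. trace (cocycle h i t 0))"
      using sum.shift_bounds_cl_nat_ivl[of "\<lambda>i. trace (cocycle h i t 0)" 1 m n]
      by (simp add: add.commute)
    finally show ?thesis
      using sum.ub_add_nat[of 1 m "\<lambda>i. trace (cocycle h i t 0)" n] by simp
  qed
  show "expectation (\<lambda>t. \<Sum>i=1..N. trace (cocycle h i t 0)) \<le> real N * l" for N
  proof -
    have "expectation (\<lambda>t. \<Sum>i=1..N. trace (cocycle h i t 0)) = (\<Sum>i=1..N. mean_trace i)"
      unfolding mean_trace_def by (intro Bochner_Integration.integral_sum integrable_cocycle)
    also have "\<dots> \<le> (\<Sum>i=1..N. l)" by (intro sum_mono l)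
    finally show ?thesis by simp
  qed
qed

text \<open>
  The factor relating the two orbits never increases, and its excess over \<open>1\<close> is multiplied by a
  fixed \<open>\<rho> < 1\<close> at each of the infinitely many times at which the orbit of \<open>0\<close> has trace at
  most \<open>b\<close>.
\<close>
lemma cocycle_forgets_start:
  assumes t: "\<And>i. t i \<in> space D" and X: "psd_matrix X"
    and inf: "\<exists>\<^sub>\<infinity>k. trace (cocycle h k t 0) \<le> b" and \<epsilon>: "0 < \<epsilon>"
  shows "eventually (\<lambda>k. cocycle h k t X \<preceq> (1 + \<epsilon>) *\<^sub>R cocycle h k t 0) sequentially"
proof -
  obtain \<rho> where \<rho>: "0 \<le> \<rho>" "\<rho> < 1" and contract: "\<And>T X Y a. T \<in> space D \<Longrightarrow> psd_matrix X \<Longrightarrow>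
      psd_matrix Y \<Longrightarrow> trace X \<le> b \<Longrightarrow> 1 \<le> a \<Longrightarrow> Y \<preceq> a *\<^sub>R X \<Longrightarrow>
      h T Y \<preceq> (1 + \<rho> * (a - 1)) *\<^sub>R h T X"
    using h_contract[of b] by metis
  obtain a where a: "1 \<le> a" "h (t 0) X \<preceq> a *\<^sub>R h (t 0) 0"
    using h_start[OF X] t by blast
  note psd = cocycle_psd[OF t]
  have persist: "cocycle h k t X \<preceq> (1 + d) *\<^sub>R cocycle h k t 0"
    if "cocycle h K t X \<preceq> (1 + d) *\<^sub>R cocycle h K t 0" "0 \<le> d" "K \<le> k" for K k d
    using that(3,1)
  proof (induction k rule: dec_induct)
    case (step k)
    then show ?case using that(2) by (auto intro!: h_scale t psd X psd_zero)
  qed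
  have reach: "\<exists>K. cocycle h K t X \<preceq> (1 + \<rho> ^ m * (a - 1)) *\<^sub>R cocycle h K t 0" for m
  proof (induction m)
    case 0
    then show ?case using a by (intro exI[of _ 1]) simp
  next
    case (Suc m)
    then obtain K where K: "cocycle h K t X \<preceq> (1 + \<rho> ^ m * (a - 1)) *\<^sub>R cocycle h K t 0" by blast
    obtain k where k: "K \<le> k" "trace (cocycle h k t 0) \<le> b"
      using inf by (auto simp: INFM_nat_le)
    have d: "0 \<le> \<rho> ^ m * (a - 1)" using \<rho> a by simp
    have "cocycle h (Suc k) t X \<preceq> (1 + \<rho> * ((1 + \<rho> ^ m * (a - 1)) - 1)) *\<^sub>R cocycle h (Suc k) t 0"
      using contract[OF t psd[OF psd_zero] psd[OF X] k(2) _ persist[OF K d k(1)]] d by simp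
    then show ?case by (intro exI[of _ "Suc k"]) (simp add: mult.assoc)
  qed
  have "(\<lambda>m. \<rho> ^ m * (a - 1)) \<longlonglongrightarrow> 0 * (a - 1)"
    by (intro tendsto_intros LIMSEQ_power_zero) (use \<rho> in auto)
  then have "eventually (\<lambda>m. \<rho> ^ m * (a - 1) < \<epsilon>) sequentially"
    using \<epsilon> by (intro order_tendstoD) auto
  then obtain m where m: "\<rho> ^ m * (a - 1) < \<epsilon>"
    by (auto simp: eventually_sequentially)
  obtain K where K: "cocycle h K t X \<preceq> (1 + \<rho> ^ m * (a - 1)) *\<^sub>R cocycle h K t 0"
    using reach by blast
  also have "(1 + \<rho> ^ m * (a - 1)) *\<^sub>R cocycle h K t 0 \<preceq> (1 + \<epsilon>) *\<^sub>R cocycle h K t 0"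
    using m by (intro loewner_scale_left psd psd_zero) auto
  finally (loewner_trans) have "cocycle h K t X \<preceq> (1 + \<epsilon>) *\<^sub>R cocycle h K t 0" .
  then show ?thesis
    using persist \<epsilon> by (intro eventually_sequentiallyI[of K]) auto
qed

text \<open>
  The orbit of \<open>0\<close> has bounded averages by \<open>trace_sum_upper\<close>, so its trace is infinitely often
  below a fixed bound and every other orbit is eventually at most \<open>1 + \<epsilon>\<close> times as large.
\<close>
lemma trace_sum_upper_any_start:
  assumes X: "psd_matrix X" and l: "\<And>k. mean_trace k \<le> l" and z: "l < z"
  shows "AE t in seq. eventually (\<lambda>N. 1 / real N * (\<Sum>i=1..N. trace (cocycle h i t X)) < z) sequentially"
proof -
  define a where "a = (l + z) / 2"
  have a: "l < a" "a < z" using z by (auto simp: a_def)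
  have a0: "0 < a" using a(1) mean_trace_nonneg[of 0] l[of 0] by linarith
  \<comment> \<open>Small enough that \<open>(1 + \<epsilon>) a\<close> still lies strictly between \<open>a\<close> and \<open>z\<close>.\<close>
  define \<epsilon> where "\<epsilon> = (z - a) / (2 * a)"
  have \<epsilon>: "0 < \<epsilon>" "(1 + \<epsilon>) * a < z" using a a0 by (auto simp: \<epsilon>_def field_simps)
  from AE_space trace_sum_upper[OF l a(1)] show ?thesis
  proof eventually_elim
    case (elim t)
    let ?u = "\<lambda>i. trace (cocycle h i t X)" and ?v = "\<lambda>i. trace (cocycle h i t 0)"
    from elim obtain c where c: "\<And>N. (\<Sum>i=1..N. ?v i) \<le> a * real N + c" by blast
    \<comment> \<open>Otherwise the traces would exceed \<open>a + 1\<close> from some time on and their sums outgrow \<open>a N + c\<close>.\<close>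
    have "\<exists>\<^sub>\<infinity>k. ?v k \<le> a + 1"
    proof (rule ccontr)
      assume "\<not> ?thesis"
      then have "\<exists>K. \<forall>k\<ge>K. a + 1 < ?v k" unfolding INFM_nat_le by (meson not_le)
      then obtain K where K: "\<And>k. K \<le> k \<Longrightarrow> a + 1 < ?v k" by blast
      obtain n :: nat where n: "c + a * real K < real n" using reals_Archimedean2 by blast
      have "real n * (a + 1) = (\<Sum>i=K + 1..K + n. a + 1)" by simp
      also have "\<dots> \<le> (\<Sum>i=K + 1..K + n. ?v i)" by (intro sum_mono less_imp_le K) auto
      also have "\<dots> \<le> (\<Sum>i=1..K + n. ?v i)"
        by (intro sum_mono2 trace_cocycle_nonneg elim psd_zero) auto
      also have "\<dots> \<le> a * real (K + n) + c" by (rule c)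
      finally show False using n by (simp add: algebra_simps)
    qed
    then have "eventually (\<lambda>k. cocycle h k t X \<preceq> (1 + \<epsilon>) *\<^sub>R cocycle h k t 0) sequentially"
      using elim \<epsilon>(1) by (intro cocycle_forgets_start in_D X)
    then obtain K where K: "\<And>k. K \<le> k \<Longrightarrow> ?u k \<le> (1 + \<epsilon>) * ?v k"
      using trace_mono unfolding trace_scale[symmetric] eventually_sequentially by blast
    have "(\<Sum>i=1..N. ?u i) \<le> (1 + \<epsilon>) * a * real N + ((1 + \<epsilon>) * c + (\<Sum>i\<le>K. ?u i))" for N
    proof -
      have pt: "?u i \<le> (1 + \<epsilon>) * ?v i + (if i \<le> K then ?u i else 0)" for i
      proof -
        have "0 \<le> (1 + \<epsilon>) * ?v i"
          using trace_cocycle_nonneg[OF elim(1) psd_zero] \<epsilon>(1) by simp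
        then show ?thesis using K[of i] by (cases "i \<le> K") auto
      qed
      have "(\<Sum>i=1..N. ?u i) \<le> (\<Sum>i=1..N. (1 + \<epsilon>) * ?v i + (if i \<le> K then ?u i else 0))"
        by (intro sum_mono pt)
      also have "\<dots> = (1 + \<epsilon>) * (\<Sum>i=1..N. ?v i) + (\<Sum>i\<in>{1..N} \<inter> {..K}. ?u i)"
        by (subst sum.inter_restrict) (simp_all add: sum.distrib sum_distrib_left)
      also have "\<dots> \<le> (1 + \<epsilon>) * (a * real N + c) + (\<Sum>i\<le>K. ?u i)"
        using \<epsilon>(1) elim X
        by (intro add_mono mult_left_mono c sum_mono2 trace_cocycle_nonneg) auto
      finally show ?thesis by (simp add: algebra_simps)
    qed
    then show ?case
      by (intro eventually_average_lt[OF always_eventually \<epsilon>(2)]) blast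
  qed
qed

text \<open>
  The almost sure bounds are collected for countably many rates \<open>mean_trace k - 1 / (i + 1)\<close> from
  below and \<open>l + 1 / (i + 1)\<close> from above, the latter only for a finite supremum \<open>l\<close>.
\<close>
theorem average_trace_tendsto:
  assumes X: "psd_matrix X"
  shows "AE t in seq. (\<lambda>N. ereal (1 / real N * (\<Sum>i=1..N. trace (cocycle h i t X))))
    \<longlonglongrightarrow> (SUP k. ereal (mean_trace k))"
proof -
  let ?avg = "\<lambda>t N. 1 / real N * (\<Sum>i=1..N. trace (cocycle h i t X))"
  let ?L = "SUP k. ereal (mean_trace k)"
  have "AE t in seq. \<forall>k i. \<exists>c. eventually (\<lambda>N. (mean_trace k - 1 / real (Suc i)) * real N - c
      \<le> (\<Sum>i=1..N. trace (cocycle h i t X))) sequentially"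
    unfolding AE_all_countable
  proof (intro allI)
    show "AE t in seq. \<exists>c. eventually (\<lambda>N. (mean_trace k - 1 / real (Suc i)) * real N - c
      \<le> (\<Sum>i=1..N. trace (cocycle h i t X))) sequentially" for k i
      by (rule trace_sum_lower[OF X, of _ k]) simp
  qed
  moreover have "AE t in seq. \<forall>i l. ?L = ereal l \<longrightarrow>
      eventually (\<lambda>N. ?avg t N < l + 1 / real (Suc i)) sequentially"
  proof (cases "?L")
    case (real l)
    then have "mean_trace k \<le> l" for k
      by (metis SUP_upper UNIV_I ereal_less_eq(3))
    then have "AE t in seq. \<forall>i. eventually (\<lambda>N. ?avg t N < l + 1 / real (Suc i)) sequentially"
      unfolding AE_all_countable by (intro allI trace_sum_upper_any_start[OF X]) auto
    then show ?thesis by eventually_elim (simp add: real)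
  qed auto
  ultimately show ?thesis
  proof eventually_elim
    case (elim t)
    show ?case
    proof (rule order_tendstoI)
      fix y assume "y < ?L"
      then obtain k where "y < ereal (mean_trace k)" by (auto simp: less_SUP_iff)
      then obtain z where z: "y < ereal z" "z < mean_trace k"
        using ereal_dense2 by (metis ereal_less_eq(3) not_le)
      obtain i where "1 / real (Suc i) < mean_trace k - z"
        using z(2) nat_approx_posE[of "mean_trace k - z"] by auto
      then have i: "z < mean_trace k - 1 / real (Suc i)" by simp
      obtain c where "eventually (\<lambda>N. (mean_trace k - 1 / real (Suc i)) * real N - c
          \<le> (\<Sum>i=1..N. trace (cocycle h i t X))) sequentially"
        using elim(1) by blast
      from eventually_average_gt[OF this i]
      show "eventually (\<lambda>N. y < ereal (?avg t N)) sequentially"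
        by eventually_elim (use z(1) in \<open>auto intro: less_trans\<close>)
    next
      fix y assume y: "?L < y"
      have "ereal (mean_trace 0) \<le> ?L" by (rule SUP_upper) simp
      then have "?L \<noteq> - \<infinity>" by auto
      moreover have "?L \<noteq> \<infinity>" using y by auto
      ultimately obtain l where l: "?L = ereal l" by (cases "?L") auto
      obtain z where z: "l < z" "ereal z < y"
        using ereal_dense2[of "ereal l" y] y l by auto
      obtain i where i: "1 / real (Suc i) < z - l"
        using z(1) nat_approx_posE[of "z - l"] by auto
      have "eventually (\<lambda>N. ?avg t N < l + 1 / real (Suc i)) sequentially"
        using elim(2) l by blast
      then show "eventually (\<lambda>N. ereal (?avg t N) < y) sequentially"
      proof eventually_elim
        case (elim N)
        then have "ereal (?avg t N) < ereal z" using i by simp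
        then show ?case using z(2) by (rule less_trans)
      qed
    qed
  qed
qed

end

section \<open>The Riccati map\<close>

definition riccati :: "real^'n^'n \<Rightarrow> real^'n^'n \<Rightarrow> real^'n^'n \<Rightarrow> real^'n^'n \<Rightarrow> real^'n^'n" where
  "riccati A Q R X = inform R (A ** X ** transpose A + Q)"

lemma prediction_pd: "pd_matrix Q \<Longrightarrow> psd_matrix X \<Longrightarrow> pd_matrix (A ** X ** transpose A + Q)"
  for A :: "real^'n^'n"
  using pd_add_psd[OF _ psd_congruence] by (simp add: add.commute)

lemma riccati_psd: "pd_matrix Q \<Longrightarrow> psd_matrix R \<Longrightarrow> psd_matrix X \<Longrightarrow> psd_matrix (riccati A Q R X)"
  unfolding riccati_def by (rule pd_imp_psd[OF inform_pd[OF _ prediction_pd]])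

lemma riccati_mono:
  assumes "pd_matrix Q" "psd_matrix R" "psd_matrix X" "psd_matrix Y" "X \<preceq> Y"
  shows "riccati A Q R X \<preceq> riccati A Q R Y"
  unfolding riccati_def
  by (intro inform_mono assms prediction_pd loewner_add_right loewner_congruence)

lemma psd_le_trace_identity: "psd_matrix X \<Longrightarrow> X \<preceq> trace X *\<^sub>R mat 1"
  by (rule loewnerI)
     (simp_all add: psd_symmetric transpose_scale transpose_mat psd_quadratic_le_trace
       scaleR_matrix_vector_assoc[symmetric])

lemma prediction_dominated:
  fixes A Q :: "real^'n^'n"
  assumes "pd_matrix Q"
  obtains k where "0 \<le> k" "\<And>X. psd_matrix X \<Longrightarrow> A ** X ** transpose A \<preceq> (k * trace X) *\<^sub>R Q"
proof -
  obtain b where b: "0 \<le> b" "\<And>X. psd_matrix X \<Longrightarrow> X \<preceq> (b * trace X) *\<^sub>R Q"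
    using psd_dominated[OF assms] by blast
  have I: "psd_matrix (mat 1 :: real^'n^'n)" by (simp add: psd_matrix_def transpose_mat)
  let ?G = "A ** mat 1 ** transpose A"
  have G: "psd_matrix ?G" by (rule psd_congruence[OF I])
  have "A ** X ** transpose A \<preceq> (b * trace ?G * trace X) *\<^sub>R Q" if X: "psd_matrix X" for X
  proof -
    have "A ** X ** transpose A \<preceq> A ** (trace X *\<^sub>R mat 1) ** transpose A"
      by (intro loewner_congruence X psd_le_trace_identity psd_scale I trace_psd_nonneg)
    also have "A ** (trace X *\<^sub>R mat 1) ** transpose A = trace X *\<^sub>R ?G"
      by (simp add: matrix_scalar_ac scalar_matrix_assoc)
    also have "trace X *\<^sub>R ?G \<preceq> trace X *\<^sub>R ((b * trace ?G) *\<^sub>R Q)"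
      by (intro loewner_scale trace_psd_nonneg X b G)
    finally (loewner_trans) show ?thesis by (simp add: mult_ac)
  qed
  moreover have "0 \<le> b * trace ?G" using b(1) trace_psd_nonneg[OF G] by simp
  ultimately show thesis using that by blast
qed

text \<open>
  If \<open>W = A X A'\<close> satisfies \<open>W \<le> k Q\<close>, then \<open>a W + Q \<le> a' (W + Q)\<close> for
  \<open>a' - 1 = k / (1 + k) (a - 1)\<close>: the noise \<open>Q\<close> is not scaled and makes up at least the fraction
  \<open>1 / (1 + k)\<close> of the prediction \<open>W + Q\<close>.
\<close>
lemma riccati_contract:
  assumes Q: "pd_matrix Q" and R: "psd_matrix R" and X: "psd_matrix X" and Y: "psd_matrix Y"
    and k: "0 \<le> k" "A ** X ** transpose A \<preceq> k *\<^sub>R Q" and a: "1 \<le> a" and le: "Y \<preceq> a *\<^sub>R X"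
  shows "riccati A Q R Y \<preceq> (1 + k / (1 + k) * (a - 1)) *\<^sub>R riccati A Q R X"
  unfolding riccati_def
proof (rule inform_scale[OF R])
  let ?W = "A ** X ** transpose A" and ?a = "1 + k / (1 + k) * (a - 1)"
  show "1 \<le> ?a" using k(1) a by simp
  have "A ** Y ** transpose A \<preceq> A ** (a *\<^sub>R X) ** transpose A"
    using a by (intro loewner_congruence Y psd_scale X le) simp
  also have "A ** (a *\<^sub>R X) ** transpose A = a *\<^sub>R ?W"
    by (simp add: matrix_scalar_ac scalar_matrix_assoc)
  finally have 1: "A ** Y ** transpose A + Q \<preceq> a *\<^sub>R ?W + Q" by (rule loewner_add_right)
  have "psd_matrix (((a - 1) / (1 + k)) *\<^sub>R (k *\<^sub>R Q - ?W))"
    using k a by (intro psd_scale) (auto simp: loewner_le_def)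
  also have "((a - 1) / (1 + k)) *\<^sub>R (k *\<^sub>R Q - ?W) = (?a - 1) *\<^sub>R Q - (a - ?a) *\<^sub>R ?W"
  proof -
    have "(a - 1) / (1 + k) = a - ?a" using k(1) by (simp add: field_simps)
    moreover have "(a - 1) / (1 + k) * k = ?a - 1" by simp
    ultimately show ?thesis by (simp add: scaleR_diff_right)
  qed
  also have "\<dots> = ?a *\<^sub>R (?W + Q) - (a *\<^sub>R ?W + Q)"
    by (simp only: scaleR_diff_left scaleR_add_right scaleR_one) (simp add: algebra_simps)
  finally have "a *\<^sub>R ?W + Q \<preceq> ?a *\<^sub>R (?W + Q)" unfolding loewner_le_def .
  with 1 show "A ** Y ** transpose A + Q \<preceq> ?a *\<^sub>R (?W + Q)" by (rule loewner_trans)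
qed (intro prediction_pd Q X Y)+

lemma riccati_start:
  assumes Q: "pd_matrix Q" and R: "psd_matrix R" and X: "psd_matrix X"
    and k: "0 \<le> k" "A ** X ** transpose A \<preceq> k *\<^sub>R Q"
  shows "riccati A Q R X \<preceq> (1 + k) *\<^sub>R riccati A Q R 0"
  unfolding riccati_def
proof (rule inform_scale[OF R])
  show "A ** X ** transpose A + Q \<preceq> (1 + k) *\<^sub>R (A ** 0 ** transpose A + Q)"
    using loewner_add_right[OF k(2), of Q] by (simp add: scaleR_add_left add.commute)
qed (use k(1) in \<open>auto intro!: prediction_pd Q X psd_zero\<close>)

section \<open>Random selection of subtrees\<close>

definition information :: "real^'n^'m \<Rightarrow> ('m \<Rightarrow> real) \<Rightarrow> 'm option pair_pre_digraph \<Rightarrow> real^'n^'n" where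
  "information C r T = (\<Sum>i \<in> sensors T.
     (1 / r i) *\<^sub>R (transpose (rowvector (row i C) :: real^'n^1) ** rowvector (row i C)))"

lemma information_psd: "(\<And>i. 0 < r i) \<Longrightarrow> psd_matrix (information C r T)"
  unfolding information_def by (intro psd_sum psd_scale psd_gram) (simp add: less_imp_le)

lemma g_tree_eq_riccati: "g_tree A Q C r T X = riccati A Q (information C r T) X"
  by (simp add: g_tree_def riccati_def inform_def information_def)

lemma finite_rooted_subtrees:
  fixes G :: "('m :: finite) option pair_pre_digraph"
  shows "finite (rooted_subtrees G)"
proof -
  have "inj (\<lambda>T :: 'm option pair_pre_digraph. (pverts T, parcs T))"
    by (rule injI) simp
  moreover have "finite (range (\<lambda>T :: 'm option pair_pre_digraph. (pverts T, parcs T)))"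
    by (rule finite_subset[OF subset_UNIV]) simp
  ultimately have "finite (UNIV :: 'm option pair_pre_digraph set)"
    by (rule finite_imageD[rotated])
  then show ?thesis by (rule finite_subset[OF subset_UNIV])
qed

lemma random_iteration_g_tree:
  fixes A Q :: "real^'n^'n" and C :: "real^'n^'m"
  assumes Q: "pd_matrix Q" and r: "\<And>i. 0 < r i"
    and D: "prob_space D" "finite (space D)" "sets D = Pow (space D)"
  shows "random_iteration D (g_tree A Q C r)"
proof (rule random_iteration.intro)
  note R = information_psd[OF r, of C]
  obtain k where k: "0 \<le> k" "\<And>X :: real^'n^'n. psd_matrix X \<Longrightarrow> A ** X ** transpose A \<preceq> (k * trace X) *\<^sub>R Q"
    using prediction_dominated[OF Q] by blast
  show "psd_matrix (g_tree A Q C r T X)" if "psd_matrix X" for T X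
    unfolding g_tree_eq_riccati by (intro riccati_psd Q R that)
  show "g_tree A Q C r T X \<preceq> g_tree A Q C r T Y"
    if "psd_matrix X" "psd_matrix Y" "X \<preceq> Y" for T X Y
    unfolding g_tree_eq_riccati by (intro riccati_mono Q R that)
  show "\<exists>\<rho>. 0 \<le> \<rho> \<and> \<rho> < 1 \<and> (\<forall>T X Y a. T \<in> space D \<longrightarrow> psd_matrix X \<longrightarrow>
      psd_matrix Y \<longrightarrow> trace X \<le> b \<longrightarrow> 1 \<le> a \<longrightarrow> Y \<preceq> a *\<^sub>R X \<longrightarrow>
      g_tree A Q C r T Y \<preceq> (1 + \<rho> * (a - 1)) *\<^sub>R g_tree A Q C r T X)" for b
  proof (intro exI[of _ "k * max 0 b / (1 + k * max 0 b)"] conjI allI impI)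
    have nn: "0 \<le> k * max 0 b" using k(1) by simp
    then show "0 \<le> k * max 0 b / (1 + k * max 0 b)" "k * max 0 b / (1 + k * max 0 b) < 1"
      by (simp_all add: divide_less_eq)
    fix T a and X Y :: "real^'n^'n"
    assume *: "psd_matrix X" "psd_matrix Y" "trace X \<le> b" "1 \<le> a" "Y \<preceq> a *\<^sub>R X"
    have "A ** X ** transpose A \<preceq> (k * trace X) *\<^sub>R Q" by (rule k(2)[OF *(1)])
    also have "(k * trace X) *\<^sub>R Q \<preceq> (k * max 0 b) *\<^sub>R Q"
      using k(1) *(3) by (intro loewner_scale_left mult_left_mono pd_imp_psd Q) auto
    finally (loewner_trans) show "g_tree A Q C r T Y
        \<preceq> (1 + k * max 0 b / (1 + k * max 0 b) * (a - 1)) *\<^sub>R g_tree A Q C r T X"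
      unfolding g_tree_eq_riccati using k(1) by (intro riccati_contract Q R *) auto
  qed
  show "\<exists>a\<ge>1. \<forall>T\<in>space D. g_tree A Q C r T X \<preceq> a *\<^sub>R g_tree A Q C r T 0"
    if X: "psd_matrix X" for X
  proof (intro exI[of _ "1 + k * trace X"] conjI ballI)
    have nn: "0 \<le> k * trace X" using k(1) trace_psd_nonneg[OF X] by simp
    then show "1 \<le> 1 + k * trace X" by simp
    show "g_tree A Q C r T X \<preceq> (1 + k * trace X) *\<^sub>R g_tree A Q C r T 0" for T
      unfolding g_tree_eq_riccati by (intro riccati_start Q R X nn k(2))
  qed
qed (rule D)+

lemma g_random_selected:
  fixes G :: "('m :: finite) option pair_pre_digraph"
  assumes "s k \<in> rooted_subtrees G"
  shows "g_random A Q C r G s k X = g_tree A Q C r (s k) X"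
proof -
  have "g_random A Q C r G s k X
    = (\<Sum>T\<in>rooted_subtrees G. if s k = T then g_tree A Q C r T X else 0)"
    unfolding g_random_def by (intro sum.cong) auto
  then show ?thesis using assms by (simp add: finite_rooted_subtrees)
qed

lemma g_iter_eq_cocycle:
  fixes G :: "('m :: finite) option pair_pre_digraph"
  assumes "\<And>k. 1 \<le> k \<Longrightarrow> s k \<in> rooted_subtrees G"
  shows "g_iter A Q C r G s k X = cocycle (g_tree A Q C r) k (\<lambda>i. s (Suc i)) X"
  by (induction k) (simp_all add: g_random_selected assms)

lemma bounded_linear_trace: "bounded_linear (trace :: real^'n^'n \<Rightarrow> real)"
  unfolding linear_conv_bounded_linear[symmetric]
  by (rule linearI) (simp_all add: trace_add trace_scale)

theorem theorem1:
  fixes A Q Sig :: "real^'n^'n"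
    and C :: "real^'n^'m"
    and r c :: "'m \<Rightarrow> real"
    and Ed :: real
    and G :: "'m option pair_pre_digraph"
    and pistar :: "'m option pair_pre_digraph \<Rightarrow> real"
    and M :: "'w measure"
    and S :: "nat \<Rightarrow> 'w \<Rightarrow> 'm option pair_pre_digraph"
    and P :: "nat \<Rightarrow> 'w \<Rightarrow> real^'n^'n"
  assumes Q_pd: "pd_matrix Q"
    and Sig_pd: "pd_matrix Sig"
    and C_obs: "observable UNIV C A"
    and r_pos: "\<And>i. 0 < r i"
    and network: "sensor_network G"
    and minimizer:
      "is_arg_min (\<lambda>\<pi>. ext_trace (g_limit A Q C r G \<pi> Sig)) (feasible G c Ed) pistar"
    and A_inv: "invertible A"
    and A_contr: "controllable A (psd_sqrt Q)"
    and T_obs: "\<exists>T \<in> rooted_subtrees G. 0 < pistar T \<and> observable (sensors T) C A"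
    and prob_M: "prob_space M"
    and S_indep: "prob_space.indep_vars M (\<lambda>_. count_space (rooted_subtrees G)) S {1..}"
    and S_distr:
      "\<And>k T. k \<ge> 1 \<Longrightarrow> T \<in> rooted_subtrees G \<Longrightarrow> measure M {\<omega> \<in> space M. S k \<omega> = T} = pistar T"
    and P_0: "\<And>\<omega>. \<omega> \<in> space M \<Longrightarrow> P 0 \<omega> = Sig"
    and P_step: "\<And>k \<omega>. k \<ge> 1 \<Longrightarrow> \<omega> \<in> space M \<Longrightarrow>
      P k \<omega> = g_random A Q C r G (\<lambda>j. S j \<omega>) k (P (k - 1) \<omega>)"
  shows "AE \<omega> in M. \<exists>L::ereal. 0 \<le> L \<and>
    (\<lambda>N. ereal ((1 / real N) * (\<Sum>k=1..N. trace (P k \<omega>)))) \<longlonglongrightarrow> L \<and>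
    L \<le> ext_trace (g_limit A Q C r G pistar Sig)"
proof -
  interpret M: prob_space M by (rule prob_M)
  let ?R = "rooted_subtrees G" and ?h = "g_tree A Q C r"
  define D where "D = point_measure ?R (\<lambda>T. ennreal (pistar T))"
  define sel where "sel = selection_measure G pistar"
  have sel: "sel = (\<Pi>\<^sub>M k\<in>{1..}. D)" by (simp add: sel_def selection_measure_def D_def)
  have pistar: "\<And>T. T \<in> ?R \<Longrightarrow> 0 \<le> pistar T" "(\<Sum>T\<in>?R. pistar T) = 1"
    using minimizer by (auto simp: is_arg_min_def feasible_def)
  have space_D: "space D = ?R" and sets_D: "sets D = Pow ?R"
    by (simp_all add: D_def space_point_measure sets_point_measure)
  have prob_D: "prob_space D"
    unfolding D_def using pistar
    by (intro prob_space_point_measure finite_rooted_subtrees) (simp_all add: sum_ennreal)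
  interpret random_iteration D ?h
    by (rule random_iteration_g_tree)
       (simp_all add: Q_pd r_pos prob_D space_D sets_D finite_rooted_subtrees)

  \<comment> \<open>The observed selections and the coordinates of \<open>selection_measure\<close> have the same joint law;
     after renumbering the times from \<open>0\<close>, it is the product measure \<open>seq\<close>.\<close>
  have S_meas: "S k \<in> measurable M (count_space ?R)" if "1 \<le> k" for k
    using S_indep that by (auto simp: M.indep_vars_def)
  have S_in: "S k \<omega> \<in> ?R" if "1 \<le> k" "\<omega> \<in> space M" for k \<omega>
    using measurable_space[OF S_meas[OF that(1)] that(2)] by simp
  have law: "distr M (count_space ?R) (S k) = D" if k: "1 \<le> k" for k
  proof (rule measure_eqI_finite[of _ ?R])
    show "finite ?R" by (rule finite_rooted_subtrees)
    fix T assume T: "T \<in> ?R"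
    have "emeasure (distr M (count_space ?R) (S k)) {T} = emeasure M {\<omega> \<in> space M. S k \<omega> = T}"
      using T by (subst emeasure_distr[OF S_meas[OF k]]) (auto intro!: arg_cong[of _ _ "emeasure M"])
    also have "\<dots> = ennreal (pistar T)"
      by (simp add: M.emeasure_eq_measure S_distr[OF k T])
    also have "\<dots> = emeasure D {T}"
      using T by (simp add: D_def emeasure_point_measure_finite finite_rooted_subtrees)
    finally show "emeasure (distr M (count_space ?R) (S k)) {T} = emeasure D {T}" .
  qed (simp_all add: sets_D space_D)
  have distr_M: "distr M (\<Pi>\<^sub>M k\<in>{1..}. count_space ?R) (\<lambda>\<omega>. \<lambda>k\<in>{1..}. S k \<omega>) = sel"
  proof -
    have "distr M (\<Pi>\<^sub>M k\<in>{1..}. count_space ?R) (\<lambda>\<omega>. \<lambda>k\<in>{1..}. S k \<omega>)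
      = (\<Pi>\<^sub>M k\<in>{1..}. distr M (count_space ?R) (S k))"
      using S_indep by (subst (asm) M.indep_vars_iff_distr_eq_PiM') (auto intro: S_meas)
    also have "\<dots> = sel" unfolding sel by (intro PiM_cong refl law) auto
    finally show ?thesis .
  qed
  have shift_meas: "(\<lambda>s k. s (Suc k)) \<in> measurable sel seq"
    unfolding sel by (rule measurable_PiM_single') (auto simp: space_PiM)
  have distr_sel: "distr sel seq (\<lambda>s k. s (Suc k)) = seq"
    unfolding sel using distr_PiM_reindex[of "{1..}" "\<lambda>_. D" Suc UNIV] prob_D
    by (simp add: restrict_def)

  \<comment> \<open>The mean covariances are expectations over \<open>seq\<close>, hence comparable with \<open>mean_trace\<close>.\<close>
  have g_mean: "g_mean A Q C r G pistar k Sig = expectation (\<lambda>t. cocycle ?h k t Sig)" for k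
  proof -
    have "g_mean A Q C r G pistar k Sig = (\<integral>s. cocycle ?h k (\<lambda>i. s (Suc i)) Sig \<partial>sel)"
      unfolding g_mean_def sel_def[symmetric]
    proof (rule Bochner_Integration.integral_cong[OF refl])
      fix s assume "s \<in> space sel"
      then have "s k \<in> ?R" if "1 \<le> k" for k
        using that by (auto simp: sel space_PiM space_D)
      then show "g_iter A Q C r G s k Sig = cocycle ?h k (\<lambda>i. s (Suc i)) Sig"
        by (rule g_iter_eq_cocycle)
    qed
    also have "\<dots> = (\<integral>t. cocycle ?h k t Sig \<partial>distr sel seq (\<lambda>s k. s (Suc k)))"
      by (rule integral_distr[symmetric, OF shift_meas measurable_cocycle])
    finally show ?thesis unfolding distr_sel .
  qed
  have psd_Sig: "psd_matrix Sig" by (rule pd_imp_psd[OF Sig_pd])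
  have mean_le: "mean_trace k \<le> trace (g_mean A Q C r G pistar k Sig)" for k
  proof -
    have "mean_trace k \<le> expectation (\<lambda>t. trace (cocycle ?h k t Sig))"
      unfolding mean_trace_def
      using trace_cocycle_shift_le[OF _ psd_Sig, of _ k 0]
      by (intro integral_mono integrable_cocycle) simp
    also have "\<dots> = trace (g_mean A Q C r G pistar k Sig)"
      unfolding g_mean by (rule integral_bounded_linear[OF bounded_linear_trace integrable_cocycle])
    finally show ?thesis .
  qed
  define L where "L = (SUP k. ereal (mean_trace k))"
  have L_nonneg: "0 \<le> L"
    unfolding L_def using mean_trace_nonneg by (intro SUP_upper2[of 0]) auto
  \<comment> \<open>If the means do not converge, the bound is \<open>\<infinity>\<close>; otherwise pass to the limit in \<open>mean_le\<close>.\<close>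
  have L_le: "L \<le> ext_trace (g_limit A Q C r G pistar Sig)"
  proof (cases "convergent (\<lambda>k. g_mean A Q C r G pistar k Sig)")
    case True
    let ?l = "lim (\<lambda>k. g_mean A Q C r G pistar k Sig)"
    have lim: "(\<lambda>k. trace (g_mean A Q C r G pistar k Sig)) \<longlonglongrightarrow> trace ?l"
      using True by (intro bounded_linear.tendsto[OF bounded_linear_trace]) (simp add: convergent_LIMSEQ_iff)
    have "mean_trace j \<le> trace ?l" for j
    proof (rule LIMSEQ_le_const[OF lim], intro exI allI impI)
      fix k assume "j \<le> k"
      then show "mean_trace j \<le> trace (g_mean A Q C r G pistar k Sig)"
        using incseqD[OF incseq_mean_trace] mean_le order_trans by blast
    qed
    then show ?thesis
      using True by (simp add: L_def g_limit_def ext_trace_def SUP_le_iff)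
  qed (simp add: g_limit_def ext_trace_def)

  have "AE t in distr sel seq (\<lambda>s k. s (Suc k)).
      (\<lambda>N. ereal (1 / real N * (\<Sum>k=1..N. trace (cocycle ?h k t Sig)))) \<longlonglongrightarrow> L"
    unfolding distr_sel L_def by (rule average_trace_tendsto[OF psd_Sig])
  then have "AE s in distr M (\<Pi>\<^sub>M k\<in>{1..}. count_space ?R) (\<lambda>\<omega>. \<lambda>k\<in>{1..}. S k \<omega>).
      (\<lambda>N. ereal (1 / real N * (\<Sum>k=1..N. trace (cocycle ?h k (\<lambda>i. s (Suc i)) Sig)))) \<longlonglongrightarrow> L"
    unfolding distr_M by (rule AE_distrD[OF shift_meas])
  then have "AE \<omega> in M.
      (\<lambda>N. ereal (1 / real N * (\<Sum>k=1..N. trace (cocycle ?h k (\<lambda>i. (\<lambda>k\<in>{1..}. S k \<omega>) (Suc i)) Sig))))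
      \<longlonglongrightarrow> L"
    by (rule AE_distrD[rotated]) (intro measurable_restrict S_meas, simp)
  with AE_space show ?thesis
  proof eventually_elim
    case (elim \<omega>)
    have "P k \<omega> = cocycle ?h k (\<lambda>i. S (Suc i) \<omega>) Sig" for k
      using elim(1) by (induction k) (simp_all add: P_0 P_step g_random_selected S_in)
    then show ?case using elim(2) L_nonneg L_le by (intro exI[of _ L]) simp
  qed
qed

end
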